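(* Let $n$, $t$ and $k$ be three positive integers with $2\le k\le n-2$, $1\le t\le \frac{n-k}{2}$ and $n\equiv k \pmod 2$. Let $G$ be a $t$-connected graph of order $n\ge 9k+10t-11$, and let $\alpha(G)$ be the matching number of $G$. If $\mu(G)\le \mu\big(K_{t}\vee (K_{n+1-2t-k}+(t+k-1)K_1)\big)$, then $\alpha(G)>\frac{n-k}{2}$ unless $G\cong K_{t}\vee (K_{n+1-2t-k}+(t+k-1)K_1)$.
   Context: All graphs are finite, simple and connected. The connectivity of a graph $G$ is the minimum number of vertices whose deletion induces a non-connected graph or a single vertex; $G$ is $t$-connected if its connectivity is at least $t$. The matching number $\alpha(G)$ is the maximum size of a set of pairwise nonadjacent (disjoint) edges of $G$. For a connected graph $G$ with vertices $v_1,\dots,v_n$, the distance matrix is $D(G)=(d_{ij})_{n\times n}$, where $d_{ij}$ is the length of a shortest path between $v_i$ and $v_j$; the distance spectral radius $\mu(G)$ is the largest eigenvalue of $D(G)$. $K_m$ is the complete graph on $m$ vertices; $G_1+G_2$ is the disjoint union of $G_1$ and $G_2$; $mK_1$ is the disjoint union of $m$ copies of $K_1$; the join $G_1\vee G_2$ is obtained from $G_1+G_2$ by adding all possible edges between $V(G_1)$ and $V(G_2)$. *)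

theory Defs
  imports
    "HOL-Number_Theory.Cong"
    "HOL-Library.Disjoint_Sets"
    "Graph_Theory.Graph_Theory"
    "Jordan_Normal_Form.Char_Poly"
begin

text \<open>
  A finite simple graph is a \<^const>\<open>pair_graph\<close>: a finite vertex set together with a symmetric
  irreflexive set of ordered pairs.
\<close>

section \<open>Connectivity and matchings\<close>

text \<open>
  Only proper subsets \<open>S\<close> are deleted, so that the null graph, for which
  \<^const>\<open>Digraph_Component.connected\<close> is false by convention, plays no role.
\<close>

definition connectivity :: "'a pair_pre_digraph \<Rightarrow> nat" where
  "connectivity G = (LEAST c. \<exists>S. S \<subset> pverts G \<and> card S = c \<and>
     (\<not> Digraph_Component.connected (with_proj G \<restriction> (pverts G - S)) \<or> card (pverts G - S) = 1))"

definition t_connected :: "nat \<Rightarrow> 'a pair_pre_digraph \<Rightarrow> bool" where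
  "t_connected t G \<longleftrightarrow> t \<le> connectivity G"

text \<open>The two arcs \<open>(u, v)\<close> and \<open>(v, u)\<close> represent the single edge \<open>{u, v}\<close>.\<close>

definition edge_set :: "'a pair_pre_digraph \<Rightarrow> 'a set set" where
  "edge_set G = (\<lambda>(u, v). {u, v}) ` parcs G"

definition is_matching :: "'a pair_pre_digraph \<Rightarrow> 'a set set \<Rightarrow> bool" where
  "is_matching G M \<longleftrightarrow> M \<subseteq> edge_set G \<and> disjoint M"

definition matching_number :: "'a pair_pre_digraph \<Rightarrow> nat" where
  "matching_number G = Max (card ` {M. is_matching G M})"

section \<open>Distance matrix and distance spectral radius\<close>

definition graph_dist :: "'a pair_pre_digraph \<Rightarrow> 'a \<Rightarrow> 'a \<Rightarrow> nat" where
  "graph_dist G u v = (LEAST l. \<exists>p. pre_digraph.apath (with_proj G) u p v \<and> length p = l)"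

definition distance_matrix_wrt :: "'a pair_pre_digraph \<Rightarrow> 'a list \<Rightarrow> real mat" where
  "distance_matrix_wrt G vs =
     mat (length vs) (length vs) (\<lambda>(i, j). real (graph_dist G (vs ! i) (vs ! j)))"

text \<open>
  The choice of the enumeration \<open>v\<^sub>1, \<dots>, v\<^sub>n\<close> of the vertices does not affect the eigenvalues; see
  \<open>eigenvalue_distance_matrix_wrt_iff\<close> below.
\<close>

definition distance_matrix :: "'a pair_pre_digraph \<Rightarrow> real mat" where
  "distance_matrix G = distance_matrix_wrt G (SOME vs. distinct vs \<and> set vs = pverts G)"

text \<open>
  The distance matrix is real symmetric, so all of its eigenvalues are real and the largest one is
  the maximum of its real eigenvalues.
\<close>

definition distance_spectral_radius :: "'a pair_pre_digraph \<Rightarrow> real" where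
  "distance_spectral_radius G = Max {x. eigenvalue (distance_matrix G) x}"

section \<open>Complete graphs, disjoint unions and joins\<close>

definition complete_graph :: "nat \<Rightarrow> nat pair_pre_digraph" where
  "complete_graph m = \<lparr> pverts = {..<m}, parcs = {(i, j). i < m \<and> j < m \<and> i \<noteq> j} \<rparr>"

definition disjoint_union ::
    "'a pair_pre_digraph \<Rightarrow> 'b pair_pre_digraph \<Rightarrow> ('a + 'b) pair_pre_digraph" where
  "disjoint_union G H =
     \<lparr> pverts = pverts G <+> pverts H,
       parcs = map_prod Inl Inl ` parcs G \<union> map_prod Inr Inr ` parcs H \<rparr>"

definition disjoint_copies :: "nat \<Rightarrow> 'a pair_pre_digraph \<Rightarrow> (nat \<times> 'a) pair_pre_digraph" where
  "disjoint_copies m G =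
     \<lparr> pverts = {..<m} \<times> pverts G,
       parcs = {((i, u), (i, v)) | i u v. i < m \<and> (u, v) \<in> parcs G} \<rparr>"

definition graph_join ::
    "'a pair_pre_digraph \<Rightarrow> 'b pair_pre_digraph \<Rightarrow> ('a + 'b) pair_pre_digraph" where
  "graph_join G H =
     \<lparr> pverts = pverts (disjoint_union G H),
       parcs = parcs (disjoint_union G H)
         \<union> (Inl ` pverts G) \<times> (Inr ` pverts H) \<union> (Inr ` pverts H) \<times> (Inl ` pverts G) \<rparr>"

text \<open>\<open>K\<^sub>t \<or> (K\<^bsub>n+1-2t-k\<^esub> + (t+k-1)K\<^sub>1)\<close>, of order \<open>n\<close> when \<open>1 \<le> t\<close> and \<open>2t + k \<le> n + 1\<close>.\<close>

definition extremal_graph :: "nat \<Rightarrow> nat \<Rightarrow> nat \<Rightarrow> (nat + nat + nat \<times> nat) pair_pre_digraph" where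
  "extremal_graph n t k =
     graph_join (complete_graph t)
       (disjoint_union (complete_graph (n + 1 - 2 * t - k))
          (disjoint_copies (t + k - 1) (complete_graph 1)))"

section \<open>Basic facts\<close>

lemma complete_graph_complete_digraph: "complete_digraph m (with_proj (complete_graph m))"
  by (auto simp: complete_digraph_pair_def complete_graph_def)

lemma pair_graph_complete_graph: "pair_graph (complete_graph m)"
  using complete_graph_complete_digraph[of m]
  by (auto simp: complete_digraph_def intro: pair_graphI_graph)

lemma pair_graphI':
  assumes "finite (pverts G)" "parcs G \<subseteq> pverts G \<times> pverts G" "sym (parcs G)" "irrefl (parcs G)"
  shows "pair_graph G"
proof -
  have "finite (parcs G)"
    using assms(1,2) by (meson finite_SigmaI finite_subset)
  with assms show ?thesis
    by unfold_locales (auto simp: symmetric_def irrefl_def)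
qed

lemma sym_map_prod_image:
  assumes "sym r"
  shows "sym (map_prod f f ` r)"
proof (rule symI)
  fix x y assume "(x, y) \<in> map_prod f f ` r"
  then obtain a b where "(a, b) \<in> r" "x = f a" "y = f b" by auto
  moreover have "(b, a) \<in> r" using assms \<open>(a, b) \<in> r\<close> by (rule symD)
  ultimately show "(y, x) \<in> map_prod f f ` r"
    by (intro image_eqI[of _ _ "(b, a)"]) simp_all
qed

lemma pair_graph_disjoint_union:
  assumes "pair_graph G" "pair_graph H"
  shows "pair_graph (disjoint_union G H)"
proof -
  interpret G: pair_graph G by fact
  interpret H: pair_graph H by fact
  show ?thesis
  proof (rule pair_graphI')
    show "finite (pverts (disjoint_union G H))"
      using G.pair_finite_verts H.pair_finite_verts by (simp add: disjoint_union_def)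
    show "parcs (disjoint_union G H) \<subseteq> pverts (disjoint_union G H) \<times> pverts (disjoint_union G H)"
      using G.wellformed' H.wellformed' by (fastforce simp: disjoint_union_def)
    show "sym (parcs (disjoint_union G H))"
      unfolding disjoint_union_def using G.arcs_symmetric H.arcs_symmetric
      by (simp add: sym_Un sym_map_prod_image symI)
    show "irrefl (parcs (disjoint_union G H))"
      unfolding irrefl_def disjoint_union_def
      using G.no_loops' H.no_loops' by fastforce
  qed
qed

lemma pair_graph_graph_join:
  assumes "pair_graph G" "pair_graph H"
  shows "pair_graph (graph_join G H)"
proof -
  interpret D: pair_graph "disjoint_union G H"
    using assms by (rule pair_graph_disjoint_union)
  have V: "pverts (disjoint_union G H) = Inl ` pverts G \<union> Inr ` pverts H"
    by (simp add: disjoint_union_def Plus_def)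
  show ?thesis
  proof (rule pair_graphI')
    show "finite (pverts (graph_join G H))"
      using D.pair_finite_verts by (simp add: graph_join_def)
    show "parcs (graph_join G H) \<subseteq> pverts (graph_join G H) \<times> pverts (graph_join G H)"
    proof -
      have "parcs (disjoint_union G H) \<subseteq> pverts (disjoint_union G H) \<times> pverts (disjoint_union G H)"
        using D.wellformed' by auto
      then show ?thesis unfolding graph_join_def by (simp add: V) blast
    qed
    show "sym (parcs (graph_join G H))"
      unfolding sym_def graph_join_def using D.arcs_symmetric by auto
    show "irrefl (parcs (graph_join G H))"
      unfolding irrefl_def graph_join_def using D.no_loops' by auto
  qed
qed

lemma pair_graph_disjoint_copies:
  assumes "pair_graph G"
  shows "pair_graph (disjoint_copies m G)"
proof -
  interpret G: pair_graph G by fact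
  show ?thesis
  proof (rule pair_graphI')
    show "finite (pverts (disjoint_copies m G))"
      using G.pair_finite_verts by (simp add: disjoint_copies_def)
    show "parcs (disjoint_copies m G) \<subseteq> pverts (disjoint_copies m G) \<times> pverts (disjoint_copies m G)"
      using G.wellformed' by (auto simp: disjoint_copies_def)
    show "sym (parcs (disjoint_copies m G))"
      unfolding sym_def disjoint_copies_def using G.arcs_symmetric by auto
    show "irrefl (parcs (disjoint_copies m G))"
      unfolding irrefl_def disjoint_copies_def using G.no_loops' by auto
  qed
qed

lemma pair_graph_extremal_graph: "pair_graph (extremal_graph n t k)"
  unfolding extremal_graph_def
  by (intro pair_graph_graph_join pair_graph_disjoint_union pair_graph_disjoint_copies
        pair_graph_complete_graph)

lemma card_pverts_extremal_graph:
  assumes "1 \<le> t" "2 * t + k \<le> n + 1"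
  shows "card (pverts (extremal_graph n t k)) = n"
  using assms
  by (simp add: extremal_graph_def graph_join_def disjoint_union_def disjoint_copies_def
        complete_graph_def card_Plus card_cartesian_product)

lemma graph_dist_eq_shortest_path:
  assumes "pair_graph G" "reachable (with_proj G) u v"
  shows "ereal (real (graph_dist G u v)) = wf_digraph.\<mu> (with_proj G) (\<lambda>_. 1) u v"
proof -
  interpret pair_graph G by fact
  have cost: "awalk_cost (\<lambda>_. 1) p = real (length p)" for p
    by (induction p) auto
  let ?P = "\<lambda>l. \<exists>p. apath u p v \<and> length p = l"
  have "\<exists>p. apath u p v"
    using assms(2) reachable_apath by blast
  then have "?P (graph_dist G u v)"
    unfolding graph_dist_def by (intro LeastI_ex[of ?P]) auto
  then obtain p where p: "apath u p v" "length p = graph_dist G u v" by blast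
  have "\<mu> (\<lambda>_. 1) u v \<le> real (graph_dist G u v)"
    using min_cost_le_walk_cost[of u p v "\<lambda>_. 1"] p awalkI_apath by (simp add: cost)
  moreover obtain q where q: "apath u q v" "\<mu> (\<lambda>_. 1) u v = awalk_cost (\<lambda>_. 1) q"
    using min_cost_awalk[of u v "\<lambda>_. 1"] assms(2) by auto
  moreover have "graph_dist G u v \<le> length q"
    unfolding graph_dist_def using q(1) by (intro Least_le) auto
  ultimately show ?thesis by (simp add: cost)
qed

lemma eigenvalue_distance_matrix_wrt:
  assumes vs: "distinct vs"
  shows "eigenvalue (distance_matrix_wrt G vs) x \<longleftrightarrow>
    (\<exists>f. (\<exists>u\<in>set vs. f u \<noteq> 0) \<and>
      (\<forall>u\<in>set vs. (\<Sum>v\<in>set vs. real (graph_dist G u v) * f v) = x * f u))"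
    (is "?L \<longleftrightarrow> ?R")
proof -
  have nth_sum: "sum g (set vs) = (\<Sum>j<length vs. g (vs ! j))" for g :: "'a \<Rightarrow> real"
    by (rule sum.reindex_bij_betw[symmetric]) (rule bij_betw_nth[OF vs refl refl])
  show ?thesis
  proof
    assume ?L
    then obtain w where w: "w \<in> carrier_vec (length vs)" "w \<noteq> 0\<^sub>v (length vs)"
      "distance_matrix_wrt G vs *\<^sub>v w = x \<cdot>\<^sub>v w"
      by (auto simp: eigenvalue_def eigenvector_def distance_matrix_wrt_def)
    define f where "f u = w $ (the_inv_into {..<length vs} (\<lambda>i. vs ! i) u)" for u
    have f: "f (vs ! i) = w $ i" if "i < length vs" for i
      using that vs by (simp add: f_def the_inv_into_f_f inj_on_nth)
    have "\<exists>i<length vs. w $ i \<noteq> 0"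
      using w(1,2) by (metis carrier_vecD eq_vecI index_zero_vec)
    then have "\<exists>u\<in>set vs. f u \<noteq> 0" using f by (metis nth_mem)
    moreover have "(\<Sum>v\<in>set vs. real (graph_dist G u v) * f v) = x * f u" if "u \<in> set vs" for u
    proof -
      obtain i where i: "i < length vs" "u = vs ! i" using \<open>u \<in> set vs\<close> by (metis in_set_conv_nth)
      have "(distance_matrix_wrt G vs *\<^sub>v w) $ i = (x \<cdot>\<^sub>v w) $ i" using w(3) by simp
      then show ?thesis
        using i w(1) f by (simp add: nth_sum distance_matrix_wrt_def scalar_prod_def atLeast0LessThan)
    qed
    ultimately show ?R by blast
  next
    assume ?R
    then obtain f where f: "\<exists>u\<in>set vs. f u \<noteq> 0"
      "\<And>u. u \<in> set vs \<Longrightarrow> (\<Sum>v\<in>set vs. real (graph_dist G u v) * f v) = x * f u" by blast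
    define w where "w = vec (length vs) (\<lambda>i. f (vs ! i))"
    obtain i where "i < length vs" "f (vs ! i) \<noteq> 0" using f(1) by (metis in_set_conv_nth)
    then have "w $ i \<noteq> 0\<^sub>v (length vs) $ i" by (simp add: w_def)
    then have "w \<noteq> 0\<^sub>v (length vs)" by auto
    moreover have "distance_matrix_wrt G vs *\<^sub>v w = x \<cdot>\<^sub>v w"
      using f(2) by (intro eq_vecI)
        (auto simp: w_def nth_sum distance_matrix_wrt_def scalar_prod_def atLeast0LessThan)
    ultimately have "eigenvector (distance_matrix_wrt G vs) w x"
      by (simp add: eigenvector_def) (simp add: w_def distance_matrix_wrt_def)
    then show ?L by (auto simp: eigenvalue_def)
  qed
qed

lemma eigenvalue_distance_matrix_wrt_iff:
  assumes "distinct vs" "distinct ws" "set vs = set ws"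
  shows "eigenvalue (distance_matrix_wrt G vs) x \<longleftrightarrow> eigenvalue (distance_matrix_wrt G ws) x"
  using assms by (simp add: eigenvalue_distance_matrix_wrt)

end

theory Submission
  imports Defs "HOL-Analysis.Function_Topology"
begin

text \<open>
  Suppose that \<open>G\<close> has no matching with more than \<open>(n - k) / 2\<close> edges. By the Berge--Tutte formula
  there is a set \<open>S\<close> such that \<open>G - S\<close> has at least \<open>card S + k\<close> components; as \<open>k \<ge> 2\<close>, the set
  \<open>S\<close> is a separator, and \<open>t\<close>-connectedness gives \<open>card S = t + j\<close> for some \<open>j\<close>. It is
  enough to count all components instead of the odd ones, and this weaker form follows quickly from
  the exchange argument of Gallai's lemma (\<open>never_both_missed_trans\<close>, \<open>berge_barrier\<close>).

  The spectral part compares \<open>G\<close> with the extremal graph directly. Write the extremal graph as a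
  clique of size \<open>t\<close> joined to a clique of size \<open>m = n + 1 - 2t - k\<close> together with \<open>r = t + k - 1\<close>
  isolated vertices. Its Perron vector for \<open>\<mu>\<close> has three values \<open>a\<close>, \<open>b\<close>, \<open>c\<close> on these parts,
  with \<open>(\<mu> + 2) c = (\<mu> + 1 + m) b\<close> (\<open>split_join_perron\<close>). Place \<open>a\<close> onto \<open>t\<close> vertices
  of \<open>S\<close>, place \<open>c\<close> onto one representative of each of \<open>r\<close> components other than the largest one,
  and \<open>b\<close> onto all other vertices. Since nonadjacent vertices are at distance at least \<open>2\<close>, the
  quadratic form of the distance matrix of \<open>G\<close> at this vector can be compared with that of the
  extremal graph by counting nonadjacent pairs: each additional nonadjacent pair with values
  \<open>b\<close>, \<open>b\<close> gains \<open>2 b\<^sup>2\<close>, each missing one with values \<open>b\<close>, \<open>c\<close> loses \<open>2 b c\<close>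
  (\<open>distance_spectral_radius_gt_split\<close>).

  Pairs are lost for two reasons only: the \<open>j\<close> vertices of \<open>S\<close> with value \<open>b\<close> may be adjacent to
  all \<open>r\<close> representatives, and each further vertex of a representative's component may be adjacent
  to that representative. The latter loss is compensated by the largest component, because
  \<open>c < 2 b\<close>. The former is compensated by the \<open>j\<close> further components that exist when \<open>S\<close> has
  \<open>j\<close> additional vertices (\<open>barrier_arrangement\<close>), and this is where the order of \<open>G\<close> must
  be large (\<open>weight_ratio\<close>). So the distance spectral radius of \<open>G\<close> exceeds \<open>\<mu>\<close> whenever
  anything is lost, and also when nothing is lost but some pair is gained. In the remaining case
  \<open>G\<close> is the extremal graph.
\<close>

section \<open>Barriers of graphs without large matchings\<close>

text \<open>
  The vertex set \<open>V\<close> is a parameter while the edge set \<open>E\<close> stays fixed, so that deleting a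
  vertex in an induction changes only \<open>V\<close>; edges that leave \<open>V\<close> are simply not usable.
\<close>

definition matching_in :: "'a set set \<Rightarrow> 'a set \<Rightarrow> 'a set set \<Rightarrow> bool" where
  "matching_in E V M \<longleftrightarrow> M \<subseteq> E \<and> \<Union>M \<subseteq> V \<and> disjoint M"

definition maximum_matching_in :: "'a set set \<Rightarrow> 'a set \<Rightarrow> 'a set set \<Rightarrow> bool" where
  "maximum_matching_in E V M \<longleftrightarrow>
     matching_in E V M \<and> (\<forall>M'. matching_in E V M' \<longrightarrow> card M' \<le> card M)"

lemma finite_matching_in:
  assumes "finite V" "matching_in E V M"
  shows "finite M"
proof -
  have "M \<subseteq> Pow V" using assms(2) by (auto simp: matching_in_def)
  then show ?thesis using assms(1) by (meson finite_Pow_iff finite_subset)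
qed

lemma card_Union_matching_in:
  assumes "finite V" "matching_in E V M" "\<And>e. e \<in> E \<Longrightarrow> card e = 2"
  shows "card (\<Union>M) = 2 * card M"
proof -
  have "card (\<Union>M) = (\<Sum>e\<in>M. card e)"
    using assms(1,2) by (intro card_Union_disjoint) (auto simp: matching_in_def intro: finite_subset)
  also have "\<dots> = (\<Sum>e\<in>M. 2)" using assms(2,3) by (intro sum.cong) (auto simp: matching_in_def)
  finally show ?thesis by simp
qed

lemma maximum_matching_in_exists:
  assumes "finite V"
  obtains M where "maximum_matching_in E V M"
proof -
  have fin: "finite {M. matching_in E V M}"
    by (rule finite_subset[of _ "Pow (Pow V)"]) (use assms in \<open>auto simp: matching_in_def\<close>)
  have "matching_in E V {}" by (auto simp: matching_in_def)
  then have ne: "card ` {M. matching_in E V M} \<noteq> {}" by auto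
  have fin': "finite (card ` {M. matching_in E V M})" using fin by simp
  obtain M where "matching_in E V M" "card M = Max (card ` {M. matching_in E V M})"
    using Max_in[OF fin' ne] by auto
  then have "maximum_matching_in E V M"
    using Max_ge[OF fin'] unfolding maximum_matching_in_def by fastforce
  then show thesis by (rule that)
qed

lemma matching_in_insert:
  assumes "matching_in E V M" "e \<in> E" "e \<subseteq> V" "e \<inter> \<Union>M = {}"
  shows "matching_in E V (insert e M)"
  using assms by (auto simp: matching_in_def disjoint_def)

lemma matching_in_subset:
  assumes "matching_in E V M" "N \<subseteq> M"
  shows "matching_in E V N"
proof -
  have "a \<inter> b = {}" if "a \<in> N" "b \<in> N" "a \<noteq> b" for a b
    using that assms disjointD[of M a b] by (auto simp: matching_in_def)
  moreover have "\<Union>N \<subseteq> V" "N \<subseteq> E" using assms by (auto simp: matching_in_def)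
  ultimately show ?thesis by (simp add: matching_in_def disjointI)
qed

text \<open>
  An edge that misses a maximum matching could be added to it.
\<close>

lemma maximum_matching_in_meets:
  assumes "finite V" "maximum_matching_in E V M" "e \<in> E" "e \<subseteq> V" "e \<noteq> {}"
  shows "e \<inter> \<Union>M \<noteq> {}"
proof
  assume disj: "e \<inter> \<Union>M = {}"
  have M: "matching_in E V M" using assms(2) by (simp add: maximum_matching_in_def)
  have "matching_in E V (insert e M)" using M assms(3,4) disj by (rule matching_in_insert)
  moreover have "e \<notin> M" using disj assms(5) by blast
  then have "card (insert e M) = Suc (card M)" using finite_matching_in[OF assms(1) M] by simp
  ultimately show False using assms(2) by (fastforce simp: maximum_matching_in_def)
qed

text \<open>
  In a graph all of whose vertices are missed by some maximum matching this is an equivalence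
  relation that contains adjacency; it takes the place of ``being in the same component''.
\<close>

definition never_both_missed :: "'a set set \<Rightarrow> 'a set \<Rightarrow> 'a \<Rightarrow> 'a \<Rightarrow> bool" where
  "never_both_missed E V u v \<longleftrightarrow>
     u = v \<or> (\<forall>M. maximum_matching_in E V M \<longrightarrow> u \<in> \<Union>M \<or> v \<in> \<Union>M)"

lemma never_both_missed_sym: "never_both_missed E V u v \<Longrightarrow> never_both_missed E V v u"
  by (auto simp: never_both_missed_def)

text \<open>
  The exchange argument behind Gallai's lemma. Suppose that a maximum matching \<open>M\<close> misses
  both \<open>u\<close> and \<open>v\<close>, and choose among the maximum matchings missing \<open>t\<close> one, \<open>N\<close>, that shares
  as many edges with \<open>M\<close> as possible. By hypothesis \<open>N\<close> covers \<open>u\<close> and \<open>v\<close>, which \<open>M\<close> misses, so by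
  counting \<open>M\<close> covers some \<open>x \<noteq> t\<close> that \<open>N\<close> misses. Let \<open>{x, y} \<in> M\<close>. Maximality of \<open>N\<close> forces
  \<open>y\<close> to be covered by \<open>N\<close>, and exchanging the edge of \<open>N\<close> at \<open>y\<close> for \<open>{x, y}\<close> yields a maximum
  matching that still misses \<open>t\<close> but shares one more edge with \<open>M\<close>.
\<close>

lemma never_both_missed_trans:
  assumes fin: "finite V" and two: "\<And>e. e \<in> E \<Longrightarrow> card e = 2"
    and t: "maximum_matching_in E V N0" "t \<notin> \<Union>N0"
    and ut: "never_both_missed E V u t" and tv: "never_both_missed E V t v"
  shows "never_both_missed E V u v"
proof (rule ccontr)
  assume "\<not> never_both_missed E V u v"
  then obtain M where M: "maximum_matching_in E V M" and uM: "u \<notin> \<Union>M" and vM: "v \<notin> \<Union>M" and uv: "u \<noteq> v"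
    by (auto simp: never_both_missed_def)
  have uneq: "u \<noteq> t" "v \<noteq> t" using \<open>\<not> never_both_missed E V u v\<close> ut tv by auto
  have tM: "t \<in> \<Union>M" using ut uneq(1) M uM unfolding never_both_missed_def by auto
  have Mm: "matching_in E V M" using M by (simp add: maximum_matching_in_def)
  note finM = finite_matching_in[OF fin Mm]
  let ?P = "\<lambda>N. maximum_matching_in E V N \<and> t \<notin> \<Union>N"
  have "?P N0" using t by simp
  moreover have "\<forall>N. ?P N \<longrightarrow> card (M \<inter> N) \<le> card M" using finM by (auto intro: card_mono)
  ultimately obtain N where N: "?P N" and Nmax: "\<forall>N'. ?P N' \<longrightarrow> card (M \<inter> N') \<le> card (M \<inter> N)"
    using ex_has_greatest_nat[of ?P N0 "\<lambda>N. card (M \<inter> N)" "Suc (card M)"] by (auto simp: less_Suc_eq_le)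
  have Nm: "matching_in E V N" using N by (simp add: maximum_matching_in_def)
  note finN = finite_matching_in[OF fin Nm]
  have uN: "u \<in> \<Union>N" and vN: "v \<in> \<Union>N"
    using ut tv uneq N unfolding never_both_missed_def by auto
  have same: "card M = card N"
    using M N Mm Nm unfolding maximum_matching_in_def by (simp add: le_antisym)
  have finU: "finite (\<Union>M)" "finite (\<Union>N)"
    using Mm Nm fin unfolding matching_in_def by (auto intro: finite_subset)
  have cardU: "card (\<Union>M) = card (\<Union>N)"
    using card_Union_matching_in[OF fin Mm two] card_Union_matching_in[OF fin Nm two] same by simp
  \<comment> \<open>\<open>\<Union>M\<close> and \<open>\<Union>N\<close> have equal size; \<open>u, v\<close> lie only in \<open>\<Union>N\<close>, while only
    \<open>t\<close> is known to lie only in \<open>\<Union>M\<close>.\<close>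
  have "\<exists>x. x \<in> \<Union>M \<and> x \<notin> \<Union>N \<and> x \<noteq> t"
  proof (rule ccontr)
    assume "\<not> ?thesis"
    then have sub: "\<Union>M - {t} \<subseteq> \<Union>N - {u, v}" using uM vM by blast
    have "card (\<Union>M - {t}) \<le> card (\<Union>N - {u, v})" using sub finU by (intro card_mono) auto
    moreover have "card (\<Union>M - {t}) = card (\<Union>M) - 1" using tM finU by simp
    moreover have "card (\<Union>N - {u, v}) = card (\<Union>N) - 2"
      using uN vN uv finU by (subst card_Diff_subset) auto
    moreover have "card {u, v} \<le> card (\<Union>N)" using uN vN finU by (intro card_mono) auto
    ultimately show False using cardU uv by simp
  qed
  then obtain x e where x: "x \<notin> \<Union>N" "x \<noteq> t" and e: "e \<in> M" "x \<in> e" by auto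
  have eE: "e \<in> E" "e \<subseteq> V" using e Mm by (auto simp: matching_in_def)
  obtain y where y: "e = {x, y}" "x \<noteq> y"
    using two[OF eE(1)] e(2) by (auto simp: card_2_iff doubleton_eq_iff)
  have "e \<inter> \<Union>N \<noteq> {}"
    using maximum_matching_in_meets[OF fin conjunct1[OF N] eE] e(2) by blast
  then have "y \<in> \<Union>N" using y x by auto
  then obtain f where f: "f \<in> N" "y \<in> f" by auto
  have ty: "t \<noteq> y" using N \<open>y \<in> \<Union>N\<close> by auto
  have ef: "e \<noteq> f" using x e f by auto
  have fM: "f \<notin> M"
  proof
    assume "f \<in> M"
    then have "e \<inter> f = {}" using e ef Mm unfolding matching_in_def disjoint_def by auto
    then show False using y f by auto
  qed
  have eN: "e \<notin> N" using x e by auto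
  define N' where "N' = insert e (N - {f})"
  have "e \<inter> \<Union>(N - {f}) = {}"
  proof -
    have "g = f" if "g \<in> N" "y \<in> g" for g
      using that f Nm disjointD[of N g f] by (auto simp: matching_in_def)
    then have "y \<notin> \<Union>(N - {f})" by blast
    then show ?thesis using y x by auto
  qed
  then have "matching_in E V N'"
    unfolding N'_def using eE matching_in_subset[OF Nm] by (intro matching_in_insert) auto
  moreover have "card N' = card N"
    unfolding N'_def using eN finN f card_Suc_Diff1[OF finN f(1)] by simp
  ultimately have "maximum_matching_in E V N'"
    using N by (auto simp: maximum_matching_in_def)
  moreover have "t \<notin> \<Union>N'" using N x(2) ty y unfolding N'_def by auto
  ultimately have "card (M \<inter> N') \<le> card (M \<inter> N)" using Nmax by blast
  moreover have "M \<inter> N' = insert e (M \<inter> N)" unfolding N'_def using e fM by auto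
  then have "card (M \<inter> N') = Suc (card (M \<inter> N))" using eN finM by simp
  ultimately show False by simp
qed

text \<open>
  The deficiency direction of the Berge--Tutte formula, with components in place of odd
  components: if every matching of \<open>V\<close> misses at least \<open>k\<close> vertices, then some \<open>S\<close> leaves at
  least \<open>card S + k\<close> mutually nonadjacent classes. The classes are given by a labelling \<open>\<kappa>\<close>, which
  avoids talking about components.

  The proof is by induction on the order. A vertex covered by every maximum matching is put into
  \<open>S\<close>; its deletion lowers the matching number by one and so raises the deficiency by one. If there
  is no such vertex, \<open>S = {}\<close> works: label each vertex by its class under
  \<^const>\<open>never_both_missed\<close>. Adjacent vertices then have the same label, whereas the vertices missed
  by one maximum matching all have different labels.
\<close>

lemma berge_barrier:
  fixes V :: "'a set"
  assumes "finite V" and "\<And>e. e \<in> E \<Longrightarrow> card e = 2"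
    and "\<And>M. matching_in E V M \<Longrightarrow> 2 * card M + k \<le> card V"
  shows "\<exists>S \<subseteq> V. \<exists>\<kappa> :: 'a \<Rightarrow> 'a set.
    (\<forall>u\<in>V - S. \<forall>v\<in>V - S. {u, v} \<in> E \<longrightarrow> \<kappa> u = \<kappa> v) \<and> card S + k \<le> card (\<kappa> ` (V - S))"
  using assms(1,3)
proof (induction "card V" arbitrary: V k rule: less_induct)
  case less
  note fin = less.prems(1) and two = assms(2) and bound = less.prems(2)
  obtain M where M: "maximum_matching_in E V M" using maximum_matching_in_exists[OF fin] .
  have Mm: "matching_in E V M" using M by (simp add: maximum_matching_in_def)
  show ?case
  proof (cases "\<exists>v\<in>V. \<forall>M. maximum_matching_in E V M \<longrightarrow> v \<in> \<Union>M")
    case True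
    then obtain v where v: "v \<in> V" "\<And>M. maximum_matching_in E V M \<Longrightarrow> v \<in> \<Union>M" by blast
    have "2 * card M' + (k + 1) \<le> card (V - {v})" if M': "matching_in E (V - {v}) M'" for M'
    proof -
      have M'V: "matching_in E V M'" "v \<notin> \<Union>M'" using M' by (auto simp: matching_in_def)
      have "\<not> maximum_matching_in E V M'" using v(2) M'V(2) by blast
      then have "card M' < card M" using M'V(1) M unfolding maximum_matching_in_def
        by (meson le_trans not_le)
      then show ?thesis using bound[OF Mm] v(1) fin by simp
    qed
    moreover have "card (V - {v}) < card V" using v(1) fin by (rule card_Diff1_less[rotated])
    ultimately obtain S and \<kappa> :: "'a \<Rightarrow> 'a set" where S: "S \<subseteq> V - {v}"
      "\<forall>x\<in>V - {v} - S. \<forall>y\<in>V - {v} - S. {x, y} \<in> E \<longrightarrow> \<kappa> x = \<kappa> y"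
      "card S + (k + 1) \<le> card (\<kappa> ` (V - {v} - S))"
      using less.hyps[of "V - {v}" "k + 1"] fin by (metis finite_Diff)
    have eq: "V - {v} - S = V - insert v S" by auto
    have "card (insert v S) = card S + 1" using S(1) fin by (subst card_insert_disjoint) (auto intro: finite_subset)
    then show ?thesis using S v(1) unfolding eq by (intro exI[of _ "insert v S"] conjI exI[of _ \<kappa>]) auto
  next
    case False
    define \<kappa> where "\<kappa> u = {w \<in> V. never_both_missed E V u w}" for u
    have trans: "never_both_missed E V u v"
      if "t \<in> V" "never_both_missed E V u t" "never_both_missed E V t v" for u t v
    proof -
      obtain N where "maximum_matching_in E V N" "t \<notin> \<Union>N" using False \<open>t \<in> V\<close> by blast
      then show ?thesis using never_both_missed_trans[OF fin two] that by blast
    qed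
    have "\<kappa> u = \<kappa> v" if "u \<in> V" "v \<in> V" "{u, v} \<in> E" for u v
    proof -
      have "never_both_missed E V u v"
        using maximum_matching_in_meets[OF fin _ \<open>{u, v} \<in> E\<close>] that(1,2)
        unfolding never_both_missed_def by fastforce
      then have "never_both_missed E V u w \<longleftrightarrow> never_both_missed E V v w" for w
        using trans[OF that(1), of v w] trans[OF that(2), of u w] never_both_missed_sym[of E V u v]
        by blast
      then show ?thesis by (simp add: \<kappa>_def)
    qed
    moreover have "k \<le> card (\<kappa> ` V)"
    proof -
      have sub: "\<Union>M \<subseteq> V" using Mm by (simp add: matching_in_def)
      have "inj_on \<kappa> (V - \<Union>M)"
      proof (rule inj_onI)
        fix u v assume uv: "u \<in> V - \<Union>M" "v \<in> V - \<Union>M" "\<kappa> u = \<kappa> v"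
        have "v \<in> \<kappa> v" using uv by (auto simp: \<kappa>_def never_both_missed_def)
        then have "never_both_missed E V u v" using uv(3) by (auto simp: \<kappa>_def)
        then show "u = v" using uv M unfolding never_both_missed_def by auto
      qed
      then have "card (V - \<Union>M) \<le> card (\<kappa> ` V)"
        using fin by (metis Diff_subset card_image card_mono finite_imageI image_mono)
      moreover have "card (V - \<Union>M) = card V - 2 * card M"
        using card_Union_matching_in[OF fin Mm two] sub fin
        by (simp add: card_Diff_subset finite_subset)
      ultimately show ?thesis using bound[OF Mm] by simp
    qed
    ultimately show ?thesis by (intro exI[of _ "{}"] exI[of _ \<kappa>]) auto
  qed
qed

section \<open>Rayleigh quotients of symmetric functions on finite sets\<close>

text \<open>
  The unit sphere of the functions on a finite set is compact. To work inside the type of all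
  functions, functions are taken to vanish outside \<open>V\<close>, which makes the sphere a closed subset of a
  product of compact intervals.
\<close>

lemma rayleigh_maximizer:
  fixes d :: "'a \<Rightarrow> 'a \<Rightarrow> real"
  assumes fin: "finite V" and ne: "V \<noteq> {}"
  obtains l f where "(\<Sum>u\<in>V. (f u)\<^sup>2) = 1"
    and "(\<Sum>u\<in>V. \<Sum>v\<in>V. d u v * f u * f v) = l"
    and "\<And>g. (\<Sum>u\<in>V. \<Sum>v\<in>V. d u v * g u * g v) \<le> l * (\<Sum>u\<in>V. (g u)\<^sup>2)"
proof -
  define Q where "Q g = (\<Sum>u\<in>V. \<Sum>v\<in>V. d u v * g u * g v)" for g :: "'a \<Rightarrow> real"
  define N where "N g = (\<Sum>u\<in>V. (g u)\<^sup>2)" for g :: "'a \<Rightarrow> real"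
  define box where "box = PiE UNIV (\<lambda>u. if u \<in> V then {-1..1::real} else {0})"
  define K where "K = box \<inter> {g. N g = 1}"
  have "compactin (product_topology (\<lambda>_. euclidean) UNIV) box"
    unfolding box_def compactin_PiE by auto
  then have box: "compact box" by (simp add: euclidean_product_topology)
  have contN: "continuous_on UNIV N" and contQ: "continuous_on UNIV Q"
    unfolding N_def Q_def by (intro continuous_intros continuous_on_product_coordinates)+
  have "closed {g. N g = 1}" using contN by (intro closed_Collect_eq continuous_on_const)
  then have K: "compact K" unfolding K_def by (rule compact_Int_closed[OF box])
  have inK: "(\<lambda>u. if u \<in> V then g u else 0) \<in> K" if "N g = 1" for g
  proof -
    have "-1 \<le> g u \<and> g u \<le> 1" if "u \<in> V" for u
    proof -
      have "(g u)\<^sup>2 \<le> N g" unfolding N_def using fin that by (intro member_le_sum) auto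
      then have "\<bar>g u\<bar> \<le> 1" using \<open>N g = 1\<close> by (simp add: abs_square_le_1)
      then show ?thesis by auto
    qed
    moreover have "N (\<lambda>u. if u \<in> V then g u else 0) = N g" unfolding N_def by (rule sum.cong) auto
    ultimately show ?thesis using that unfolding K_def box_def by auto
  qed
  obtain w where w: "w \<in> V" using ne by blast
  have "N (\<lambda>u. if u = w then 1 else 0) = 1"
    unfolding N_def using fin w by (simp add: if_distrib[of "\<lambda>x. x\<^sup>2"] cong: if_cong)
  then have "K \<noteq> {}" using inK by blast
  then obtain f where f: "f \<in> K" and fmax: "\<And>g. g \<in> K \<Longrightarrow> Q g \<le> Q f"
    using continuous_attains_sup[OF K _ continuous_on_subset[OF contQ subset_UNIV]] by blast
  define l where "l = Q f"
  have Nf: "N f = 1" using f by (simp add: K_def)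
  have max: "Q g \<le> l * N g" for g
  proof (cases "N g = 0")
    case True
    then have "g u = 0" if "u \<in> V" for u using that fin by (simp add: N_def sum_nonneg_eq_0_iff)
    then show ?thesis using True by (simp add: Q_def)
  next
    case False
    then have pos: "N g > 0" unfolding N_def by (simp add: sum_nonneg order_less_le)
    define s where "s = 1 / sqrt (N g)"
    have s2: "s\<^sup>2 = 1 / N g" using pos by (simp add: s_def power_divide)
    have "N (\<lambda>u. s * g u) = s\<^sup>2 * N g"
      unfolding N_def by (simp add: sum_distrib_left power_mult_distrib)
    then have "N (\<lambda>u. s * g u) = 1" using s2 pos by simp
    then have "Q (\<lambda>u. if u \<in> V then s * g u else 0) \<le> l" unfolding l_def by (intro fmax inK)
    also have "Q (\<lambda>u. if u \<in> V then s * g u else 0) = s\<^sup>2 * Q g"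
      unfolding Q_def sum_distrib_left by (intro sum.cong refl) (simp add: power2_eq_square)
    finally show ?thesis using s2 pos by (simp add: field_simps)
  qed
  show thesis using that[of f l] Nf max unfolding l_def Q_def N_def by simp
qed

text \<open>
  Put \<open>r = l f - d f\<close> for the residual. Moving from \<open>f\<close> to \<open>f - e r\<close> changes
  \<open>l N - Q\<close>, where \<open>Q\<close> is the quadratic form and \<open>N\<close> the squared norm, from \<open>0\<close> by
  \<open>- 2 e N(r) + O(e\<^sup>2)\<close>. As \<open>l N - Q\<close> is nowhere negative, \<open>N(r) = 0\<close>.
\<close>

lemma rayleigh_maximizer_is_eigenvector:
  fixes d :: "'a \<Rightarrow> 'a \<Rightarrow> real"
  assumes fin: "finite V" and sym: "\<And>u v. d u v = d v u"
    and max: "\<And>g. (\<Sum>u\<in>V. \<Sum>v\<in>V. d u v * g u * g v) \<le> l * (\<Sum>u\<in>V. (g u)\<^sup>2)"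
    and attained: "(\<Sum>u\<in>V. \<Sum>v\<in>V. d u v * f u * f v) = l * (\<Sum>u\<in>V. (f u)\<^sup>2)"
    and uV: "u \<in> V"
  shows "(\<Sum>v\<in>V. d u v * f v) = l * f u"
proof -
  define Q where "Q g = (\<Sum>u\<in>V. \<Sum>v\<in>V. d u v * g u * g v)" for g :: "'a \<Rightarrow> real"
  define N where "N g = (\<Sum>u\<in>V. (g u)\<^sup>2)" for g :: "'a \<Rightarrow> real"
  define r where "r u = l * f u - (\<Sum>v\<in>V. d u v * f v)" for u
  have Nexp: "N (\<lambda>u. f u + e * r u) = N f + 2 * e * (\<Sum>u\<in>V. f u * r u) + e\<^sup>2 * N r" for e
    unfolding N_def by (simp add: sum_distrib_left sum.distrib[symmetric] algebra_simps power2_eq_square)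
  have Qexp: "Q (\<lambda>u. f u + e * r u) = Q f + 2 * e * (\<Sum>u\<in>V. \<Sum>v\<in>V. d u v * f v * r u) + e\<^sup>2 * Q r" for e
  proof -
    have swap: "(\<Sum>u\<in>V. \<Sum>v\<in>V. d u v * f u * r v) = (\<Sum>u\<in>V. \<Sum>v\<in>V. d u v * f v * r u)"
      by (subst sum.swap) (simp add: sym)
    have "Q (\<lambda>u. f u + e * r u) = Q f + e * (\<Sum>u\<in>V. \<Sum>v\<in>V. d u v * f u * r v)
      + e * (\<Sum>u\<in>V. \<Sum>v\<in>V. d u v * f v * r u) + e\<^sup>2 * Q r"
      unfolding Q_def sum_distrib_left sum.distrib[symmetric]
      by (intro sum.cong refl) (simp add: algebra_simps power2_eq_square)
    then show ?thesis unfolding swap by simp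
  qed
  define B where "B = N r"
  have "(\<Sum>u\<in>V. \<Sum>v\<in>V. d u v * f v * r u) = (\<Sum>u\<in>V. (l * f u - r u) * r u)"
    unfolding r_def by (intro sum.cong refl) (simp add: sum_distrib_right)
  also have "\<dots> = l * (\<Sum>u\<in>V. f u * r u) - B"
    unfolding B_def N_def sum_distrib_left sum_subtractf[symmetric]
    by (intro sum.cong refl) (simp add: algebra_simps power2_eq_square)
  finally have cross: "(\<Sum>u\<in>V. \<Sum>v\<in>V. d u v * f v * r u) = l * (\<Sum>u\<in>V. f u * r u) - B" .
  have ineq: "2 * e * B \<le> e\<^sup>2 * (l * B - Q r)" for e
    using max[of "\<lambda>u. f u + (- e) * r u"] attained
    unfolding Q_def[symmetric] N_def[symmetric] Nexp Qexp cross B_def[symmetric]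
    by (simp add: algebra_simps)
  have "B \<le> 0"
  proof (rule ccontr)
    assume "\<not> B \<le> 0"
    define c where "c = l * B - Q r"
    have "c > 0" using ineq[of 1] \<open>\<not> B \<le> 0\<close> by (simp add: c_def)
    have "2 * (B / c) * B \<le> (B / c)\<^sup>2 * c" using ineq[of "B / c"] by (simp add: c_def)
    then show False using \<open>c > 0\<close> \<open>\<not> B \<le> 0\<close> by (simp add: power2_eq_square divide_simps)
  qed
  then have "B = 0" unfolding B_def N_def by (simp add: sum_nonneg order_antisym)
  then have "r u = 0" if "u \<in> V" for u
    using that fin by (simp add: B_def N_def sum_nonneg_eq_0_iff)
  then show ?thesis using uV by (simp add: r_def)
qed

text \<open>
  The part of Perron--Frobenius theory that is needed. Passing to absolute values does not decrease
  the quadratic form, so the maximizer can be taken nonnegative; an eigenvector equation with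
  positive off-diagonal entries then forces every coordinate to be positive.
\<close>

lemma perron_rayleigh:
  fixes d :: "'a \<Rightarrow> 'a \<Rightarrow> real"
  assumes fin: "finite V" and ne: "V \<noteq> {}" and sym: "\<And>u v. d u v = d v u"
    and nonneg: "\<And>u v. 0 \<le> d u v"
    and pos: "\<And>u v. u \<in> V \<Longrightarrow> v \<in> V \<Longrightarrow> u \<noteq> v \<Longrightarrow> 0 < d u v"
  obtains l f where "\<And>u. u \<in> V \<Longrightarrow> 0 < f u"
    and "\<And>u. u \<in> V \<Longrightarrow> (\<Sum>v\<in>V. d u v * f v) = l * f u"
    and "\<And>g. (\<Sum>u\<in>V. \<Sum>v\<in>V. d u v * g u * g v) \<le> l * (\<Sum>u\<in>V. (g u)\<^sup>2)"
proof -
  obtain l f where f: "(\<Sum>u\<in>V. (f u)\<^sup>2) = 1" "(\<Sum>u\<in>V. \<Sum>v\<in>V. d u v * f u * f v) = l"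
    and max: "\<And>g. (\<Sum>u\<in>V. \<Sum>v\<in>V. d u v * g u * g v) \<le> l * (\<Sum>u\<in>V. (g u)\<^sup>2)"
    by (rule rayleigh_maximizer[OF fin ne, of d]) (rule that)
  define h where "h u = \<bar>f u\<bar>" for u
  have "l \<le> (\<Sum>u\<in>V. \<Sum>v\<in>V. d u v * h u * h v)"
  proof -
    have "d u v * f u * f v \<le> d u v * h u * h v" for u v
    proof -
      have "f u * f v \<le> h u * h v" unfolding h_def abs_mult[symmetric] by (rule abs_ge_self)
      then show ?thesis using mult_left_mono[OF _ nonneg, of "f u * f v" "h u * h v" u v]
        by (simp add: mult.assoc)
    qed
    then show ?thesis unfolding f(2)[symmetric] by (intro sum_mono)
  qed
  moreover have h1: "(\<Sum>u\<in>V. (h u)\<^sup>2) = 1" using f(1) by (simp add: h_def)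
  ultimately have att: "(\<Sum>u\<in>V. \<Sum>v\<in>V. d u v * h u * h v) = l * (\<Sum>u\<in>V. (h u)\<^sup>2)"
    using max[of h] by simp
  have eig: "(\<Sum>v\<in>V. d u v * h v) = l * h u" if "u \<in> V" for u
    using rayleigh_maximizer_is_eigenvector[OF fin sym max att that] .
  obtain w where w: "w \<in> V" "h w \<noteq> 0"
  proof (rule ccontr)
    assume "\<not> thesis"
    then have "h u = 0" if "u \<in> V" for u using that \<open>\<And>w. w \<in> V \<Longrightarrow> h w \<noteq> 0 \<Longrightarrow> thesis\<close> by blast
    then show False using h1 by simp
  qed
  have hw: "h w > 0" using w(2) by (simp add: h_def)
  have "0 < h u" if "u \<in> V" for u
  proof (cases "u = w")
    case False
    have "0 < d u w * h w" using pos[OF that w(1) False] hw by simp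
    also have "\<dots> \<le> (\<Sum>v\<in>V. d u v * h v)"
      using fin w(1) nonneg by (intro member_le_sum) (auto simp: h_def)
    finally have "h u \<noteq> 0" using eig[OF that] by auto
    then show ?thesis by (simp add: h_def)
  qed (use hw in simp)
  then show thesis using that[of h l] eig max by simp
qed

section \<open>Distances and the distance spectral radius\<close>

lemma graph_dist_refl:
  assumes "pair_graph G" "u \<in> pverts G"
  shows "graph_dist G u u = 0"
proof -
  interpret pair_graph G by fact
  have "apath u [] u" using assms(2) by (simp add: apath_Nil_iff)
  then have "graph_dist G u u \<le> 0" unfolding graph_dist_def by (intro Least_le) auto
  then show ?thesis by simp
qed

lemma graph_dist_commute:
  assumes "pair_graph G"
  shows "graph_dist G u v = graph_dist G v u"
proof -
  interpret pair_graph G by fact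
  have "(\<exists>p. apath u p v \<and> length p = l) \<longleftrightarrow> (\<exists>p. apath v p u \<and> length p = l)" for l
  proof -
    have len: "length (rev_path p) = length p" for p :: "('a \<times> 'a) list" by (induction p) auto
    have "\<exists>q. apath y q x \<and> length q = l" if "apath x p y \<and> length p = l" for x y p
      using that len by (intro exI[of _ "rev_path p"]) simp
    then show ?thesis by blast
  qed
  then show ?thesis unfolding graph_dist_def by simp
qed

lemma graph_dist_witness:
  assumes "pair_graph G" "Digraph_Component.connected (with_proj G)" "u \<in> pverts G" "v \<in> pverts G"
  obtains p where "pre_digraph.apath (with_proj G) u p v" "length p = graph_dist G u v"
proof -
  interpret pair_graph G by fact
  have "reachable (with_proj (mk_symmetric (with_proj G))) u v"
    using assms(2-4) unfolding Digraph_Component.connected_def strongly_connected_def by simp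
  then have "reachable (with_proj G) u v" using reachable_mk_symmetric_eq sym_arcs by blast
  then have "\<exists>p. apath u p v" using reachable_apath by blast
  then have "\<exists>p. apath u p v \<and> length p = graph_dist G u v"
    unfolding graph_dist_def by (intro LeastI_ex[of "\<lambda>l. \<exists>p. apath u p v \<and> length p = l"]) auto
  then show thesis using that by blast
qed

lemma graph_dist_pos:
  assumes "pair_graph G" "Digraph_Component.connected (with_proj G)" "u \<in> pverts G" "v \<in> pverts G" "u \<noteq> v"
  shows "1 \<le> graph_dist G u v"
proof -
  interpret pair_graph G by fact
  obtain p where p: "apath u p v" "length p = graph_dist G u v"
    using graph_dist_witness[OF assms(1-4)] by blast
  then have "p \<noteq> []" using assms(5) by (auto simp: apath_Nil_iff)
  then show ?thesis using p(2) by (cases p) auto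
qed

lemma graph_dist_nonadjacent:
  assumes "pair_graph G" "Digraph_Component.connected (with_proj G)" "u \<in> pverts G" "v \<in> pverts G" "u \<noteq> v"
    and "(u, v) \<notin> parcs G"
  shows "2 \<le> graph_dist G u v"
proof -
  interpret pair_graph G by fact
  obtain p where p: "apath u p v" "length p = graph_dist G u v"
    using graph_dist_witness[OF assms(1-4)] by blast
  have "p \<noteq> []" using p(1) assms(5) by (auto simp: apath_Nil_iff)
  moreover have "p \<noteq> [e]" for e
    using p(1) assms(6) by (cases e) (auto simp: apath_Cons_iff apath_Nil_iff)
  ultimately show ?thesis using p(2) by (cases p; cases "tl p") auto
qed

lemma graph_dist_adjacent:
  assumes "pair_graph G" "(u, v) \<in> parcs G"
  shows "graph_dist G u v \<le> 1"
proof -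
  interpret pair_graph G by fact
  have "apath u [(u, v)] v"
    using assms(2) no_loops' wellformed' by (auto simp: apath_Cons_iff apath_Nil_iff)
  then show ?thesis unfolding graph_dist_def by (intro Least_le exI[of _ "[(u, v)]"]) auto
qed

lemma graph_dist_common_neighbour:
  assumes "pair_graph G" "(u, w) \<in> parcs G" "(w, v) \<in> parcs G" "u \<noteq> v"
  shows "graph_dist G u v \<le> 2"
proof -
  interpret pair_graph G by fact
  have "apath u [(u, w), (w, v)] v"
    using assms(2-4) no_loops' wellformed' by (auto simp: apath_Cons_iff apath_Nil_iff)
  then show ?thesis unfolding graph_dist_def by (intro Least_le exI[of _ "[(u, w), (w, v)]"]) auto
qed

text \<open>
  The maximum of the Rayleigh quotient is an eigenvalue, and it bounds every other eigenvalue; hence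
  it is the distance spectral radius, and it has a positive eigenvector.
\<close>

lemma distance_spectral_radius_perron:
  assumes G: "pair_graph G" and conn: "Digraph_Component.connected (with_proj G)"
  obtains f where "\<And>u. u \<in> pverts G \<Longrightarrow> 0 < f u"
    and "\<And>u. u \<in> pverts G \<Longrightarrow>
      (\<Sum>v\<in>pverts G. real (graph_dist G u v) * f v) = distance_spectral_radius G * f u"
    and "\<And>g. (\<Sum>u\<in>pverts G. \<Sum>v\<in>pverts G. real (graph_dist G u v) * g u * g v)
      \<le> distance_spectral_radius G * (\<Sum>u\<in>pverts G. (g u)\<^sup>2)"
proof -
  interpret pair_graph G by fact
  let ?d = "\<lambda>u v. real (graph_dist G u v)"
  have ne: "pverts G \<noteq> {}"
    using conn by (simp add: Digraph_Component.connected_def strongly_connected_def)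
  have pos: "0 < ?d u v" if "u \<in> pverts G" "v \<in> pverts G" "u \<noteq> v" for u v
    using graph_dist_pos[OF G conn that] by simp
  have comm: "?d u v = ?d v u" for u v using graph_dist_commute[OF G, of u v] by simp
  have nonneg: "0 \<le> ?d u v" for u v by simp
  obtain l f where f: "\<And>u. u \<in> pverts G \<Longrightarrow> 0 < f u"
    "\<And>u. u \<in> pverts G \<Longrightarrow> (\<Sum>v\<in>pverts G. ?d u v * f v) = l * f u"
    "\<And>g. (\<Sum>u\<in>pverts G. \<Sum>v\<in>pverts G. ?d u v * g u * g v) \<le> l * (\<Sum>u\<in>pverts G. (g u)\<^sup>2)"
  proof (rule perron_rayleigh[of "pverts G" ?d, OF pair_finite_verts ne comm nonneg])
    show "0 < ?d u v" if "u \<in> pverts G" "v \<in> pverts G" "u \<noteq> v" for u v using pos[OF that] .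
  qed (rule that)
  define vs where "vs = (SOME vs. distinct vs \<and> set vs = pverts G)"
  have "\<exists>vs. distinct vs \<and> set vs = pverts G"
    using finite_distinct_list[OF pair_finite_verts] by blast
  then have vs: "distinct vs" "set vs = pverts G"
    unfolding vs_def by (metis (mono_tags, lifting) someI_ex)+
  define A where "A = distance_matrix G"
  have A: "A = distance_matrix_wrt G vs" unfolding A_def distance_matrix_def vs_def ..
  have eig: "eigenvalue A x \<longleftrightarrow> (\<exists>h. (\<exists>u\<in>pverts G. h u \<noteq> 0) \<and>
      (\<forall>u\<in>pverts G. (\<Sum>v\<in>pverts G. ?d u v * h v) = x * h u))" for x
    unfolding A eigenvalue_distance_matrix_wrt[OF vs(1)] vs(2) ..
  have carr: "A \<in> carrier_mat (length vs) (length vs)"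
    unfolding A distance_matrix_wrt_def by simp
  have "char_poly A \<noteq> 0" using degree_monic_char_poly[OF carr] by auto
  then have fin: "finite {x. eigenvalue A x}"
    unfolding eigenvalue_root_char_poly[OF carr] by (rule poly_roots_finite)
  have "\<exists>u\<in>pverts G. f u \<noteq> 0" using f(1) ne by (metis equals0I less_irrefl)
  moreover have "\<forall>u\<in>pverts G. (\<Sum>v\<in>pverts G. ?d u v * f v) = l * f u" using f(2) by simp
  ultimately have "eigenvalue A l" unfolding eig by (intro exI[of _ f] conjI)
  moreover have "x \<le> l" if x: "eigenvalue A x" for x
  proof -
    obtain h where h: "\<exists>u\<in>pverts G. h u \<noteq> 0"
      "\<And>u. u \<in> pverts G \<Longrightarrow> (\<Sum>v\<in>pverts G. ?d u v * h v) = x * h u"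
      using x unfolding eig by blast
    have "x * (\<Sum>u\<in>pverts G. (h u)\<^sup>2) = (\<Sum>u\<in>pverts G. h u * (x * h u))"
      by (simp add: sum_distrib_left power2_eq_square algebra_simps)
    also have "\<dots> = (\<Sum>u\<in>pverts G. \<Sum>v\<in>pverts G. ?d u v * h u * h v)"
    proof (rule sum.cong[OF refl])
      fix u assume "u \<in> pverts G"
      then have "h u * (x * h u) = h u * (\<Sum>v\<in>pverts G. ?d u v * h v)" by (simp add: h(2))
      then show "h u * (x * h u) = (\<Sum>v\<in>pverts G. ?d u v * h u * h v)"
        by (simp add: sum_distrib_left mult_ac)
    qed
    also have "\<dots> \<le> l * (\<Sum>u\<in>pverts G. (h u)\<^sup>2)" by (rule f(3))
    finally have le: "x * (\<Sum>u\<in>pverts G. (h u)\<^sup>2) \<le> l * (\<Sum>u\<in>pverts G. (h u)\<^sup>2)" .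
    obtain u where "u \<in> pverts G" "h u \<noteq> 0" using h(1) by blast
    then have "0 < (\<Sum>u\<in>pverts G. (h u)\<^sup>2)" by (intro sum_pos2[OF pair_finite_verts]) auto
    then show ?thesis using le by simp
  qed
  ultimately have "distance_spectral_radius G = l"
    unfolding distance_spectral_radius_def A_def[symmetric] using fin by (intro Max_eqI) auto
  then show thesis using that[of f] f(1,2,3) by simp
qed

lemma rayleigh_le_distance_spectral_radius:
  assumes "pair_graph G" "Digraph_Component.connected (with_proj G)"
  shows "(\<Sum>u\<in>pverts G. \<Sum>v\<in>pverts G. real (graph_dist G u v) * g u * g v)
    \<le> distance_spectral_radius G * (\<Sum>u\<in>pverts G. (g u)\<^sup>2)"
  by (rule distance_spectral_radius_perron[OF assms])

section \<open>Separators and split joins\<close>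

text \<open>
  Along a walk of \<open>G - S\<close> the label \<open>\<kappa>\<close> is constant, so two different labels witness that
  \<open>S\<close> separates \<open>G\<close>.
\<close>

lemma connectivity_le_card_separator:
  assumes G: "pair_graph G" and S: "S \<subseteq> pverts G"
    and lab: "\<And>x y. x \<in> pverts G - S \<Longrightarrow> y \<in> pverts G - S \<Longrightarrow> (x, y) \<in> parcs G \<Longrightarrow> \<kappa> x = \<kappa> y"
    and uv: "u \<in> pverts G - S" "v \<in> pverts G - S" "\<kappa> u \<noteq> \<kappa> v"
  shows "connectivity G \<le> card S"
proof -
  interpret pair_graph G by fact
  define H where "H = with_proj G \<restriction> (pverts G - S)"
  have "\<not> Digraph_Component.connected H"
  proof
    assume "Digraph_Component.connected H"
    moreover have verts: "verts H = pverts G - S" by (simp add: H_def)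
    ultimately have reach: "reachable (with_proj (mk_symmetric H)) u v"
      using uv unfolding Digraph_Component.connected_def strongly_connected_def by simp
    interpret H: wf_digraph H unfolding H_def by (rule wellformed_induce_subgraph)
    interpret K: pair_wf_digraph "mk_symmetric H" by (rule H.wellformed_mk_symmetric)
    have step: "\<kappa> x = \<kappa> y" if "(x, y) \<in> parcs (mk_symmetric H)" for x y
      using that lab arcs_symmetric unfolding parcs_mk_symmetric H_def
      by (fastforce simp: induce_subgraph_def)
    from reach have "\<kappa> u = \<kappa> v"
    proof (induction rule: K.reachable_induct)
      case (step x y)
      then show ?case using \<open>\<And>x y. (x, y) \<in> parcs (mk_symmetric H) \<Longrightarrow> \<kappa> x = \<kappa> y\<close>[of x y] by auto
    qed simp
    then show False using uv(3) by contradiction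
  qed
  then show ?thesis
    unfolding connectivity_def H_def using S uv by (intro Least_le exI[of _ S]) auto
qed

lemma card_parts:
  assumes "finite V" "A \<subseteq> V" "T \<subseteq> V" "A \<inter> T = {}"
  shows "card V = card A + card T + card (V - A - T)"
proof -
  have "finite A" "finite T" using assms by (auto intro: finite_subset)
  then have "card (A \<union> T) = card A + card T" using assms(4) by (rule card_Un_disjoint)
  moreover have "card V = card (A \<union> T) + card (V - (A \<union> T))"
    using assms by (metis Un_least card_Diff_subset card_mono finite_subset le_add_diff_inverse)
  ultimately show ?thesis by (simp add: Diff_eq Int_assoc)
qed

text \<open>
  \<open>split_join G A T\<close> says that \<open>G\<close> is the join of the clique on \<open>A\<close> with the disjoint union of the
  independent set \<open>T\<close> and the clique on the remaining vertices. This describes the extremal graph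
  without reference to its sum types, and it can be stated for the given graph as well.
\<close>

definition split_join :: "'a pair_pre_digraph \<Rightarrow> 'a set \<Rightarrow> 'a set \<Rightarrow> bool" where
  "split_join G A T \<longleftrightarrow> pair_graph G \<and> A \<subseteq> pverts G \<and> T \<subseteq> pverts G \<and> A \<inter> T = {} \<and>
     (\<forall>u\<in>pverts G. \<forall>v\<in>pverts G.
        (u, v) \<in> parcs G \<longleftrightarrow> u \<noteq> v \<and> (u \<in> A \<or> v \<in> A \<or> u \<notin> T \<and> v \<notin> T))"

lemma split_joinD:
  assumes "split_join G A T"
  shows "A \<subseteq> pverts G" "T \<subseteq> pverts G" "A \<inter> T = {}"
  using assms by (simp_all add: split_join_def)

lemma split_join_extremal_graph:
  "split_join (extremal_graph n t k) (Inl ` {..<t}) ((\<lambda>i. Inr (Inr (i, 0))) ` {..<t + k - 1})"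
  unfolding split_join_def
proof (intro conjI pair_graph_extremal_graph)
qed (auto simp: extremal_graph_def graph_join_def disjoint_union_def disjoint_copies_def complete_graph_def)

text \<open>
  Any bijection that respects the three parts is an isomorphism.
\<close>

lemma split_join_digraph_iso:
  assumes G: "split_join G A T" and H: "split_join H B U"
    and A: "card A = card B" and T: "card T = card U" and V: "card (pverts G) = card (pverts H)"
  shows "digraph_iso (with_proj G) (with_proj H)"
proof -
  interpret G: pair_graph G using G by (simp add: split_join_def)
  interpret H: pair_graph H using H by (simp add: split_join_def)
  have sub: "A \<subseteq> pverts G" "T \<subseteq> pverts G" "A \<inter> T = {}" "B \<subseteq> pverts H" "U \<subseteq> pverts H" "B \<inter> U = {}"
    using G H by (auto simp: split_join_def)
  have fin: "finite A" "finite T" "finite B" "finite U"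
    using sub G.pair_finite_verts H.pair_finite_verts by (auto intro: finite_subset)
  have "card (pverts G - (A \<union> T)) = card (pverts H - (B \<union> U))"
    using sub fin A T V G.pair_finite_verts H.pair_finite_verts
    by (simp add: card_Diff_subset card_Un_disjoint)
  then obtain f where f: "bij_betw f (pverts G - (A \<union> T)) (pverts H - (B \<union> U))"
    using finite_same_card_bij[of "pverts G - (A \<union> T)"] G.pair_finite_verts H.pair_finite_verts by blast
  obtain g where g: "bij_betw g A B" using finite_same_card_bij[OF fin(1,3) A] by blast
  obtain h where h: "bij_betw h T U" using finite_same_card_bij[OF fin(2,4) T] by blast
  define \<phi> where "\<phi> v = (if v \<in> A then g v else if v \<in> T then h v else f v)" for v
  have "bij_betw \<phi> A B" using g by (rule bij_betw_cong[THEN iffD1, rotated]) (simp add: \<phi>_def)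
  moreover have "bij_betw \<phi> T U"
    using h by (rule bij_betw_cong[THEN iffD1, rotated]) (use sub in \<open>auto simp: \<phi>_def\<close>)
  moreover have "bij_betw \<phi> (pverts G - (A \<union> T)) (pverts H - (B \<union> U))"
    using f by (rule bij_betw_cong[THEN iffD1, rotated]) (auto simp: \<phi>_def)
  ultimately have parts: "bij_betw \<phi> A B" "bij_betw \<phi> T U"
    "bij_betw \<phi> (pverts G - (A \<union> T)) (pverts H - (B \<union> U))" .
  then have \<phi>A: "\<phi> ` A = B" and \<phi>T: "\<phi> ` T = U" by (auto simp: bij_betw_def)
  have "bij_betw \<phi> (A \<union> T) (B \<union> U)" using parts sub by (intro bij_betw_combine) auto
  then have "bij_betw \<phi> ((A \<union> T) \<union> (pverts G - (A \<union> T))) ((B \<union> U) \<union> (pverts H - (B \<union> U)))"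
    using parts(3) by (rule bij_betw_combine) auto
  moreover have "(A \<union> T) \<union> (pverts G - (A \<union> T)) = pverts G" "(B \<union> U) \<union> (pverts H - (B \<union> U)) = pverts H"
    using sub by auto
  ultimately have \<phi>: "bij_betw \<phi> (pverts G) (pverts H)" by simp
  then have inj: "inj_on \<phi> (pverts G)" and img: "\<phi> ` pverts G = pverts H" by (auto simp: bij_betw_def)
  have memA: "\<phi> v \<in> B \<longleftrightarrow> v \<in> A" and memT: "\<phi> v \<in> U \<longleftrightarrow> v \<in> T" if "v \<in> pverts G" for v
    using that \<phi>A \<phi>T sub inj by (auto dest: inj_onD)
  have arc: "(\<phi> u, \<phi> v) \<in> parcs H \<longleftrightarrow> (u, v) \<in> parcs G" if "u \<in> pverts G" "v \<in> pverts G" for u v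
  proof -
    have "\<phi> u \<in> pverts H" "\<phi> v \<in> pverts H" "\<phi> u = \<phi> v \<longleftrightarrow> u = v"
      using that img inj by (auto dest: inj_onD)
    then show ?thesis using G H that memA memT unfolding split_join_def by auto
  qed
  have arcs: "map_prod \<phi> \<phi> ` parcs G = parcs H"
  proof (intro equalityI subsetI)
    fix e assume "e \<in> map_prod \<phi> \<phi> ` parcs G"
    then show "e \<in> parcs H" using arc G.wellformed' by fastforce
  next
    fix e assume e: "e \<in> parcs H"
    obtain x y where xy: "e = (x, y)" by fastforce
    then have "x \<in> pverts H" "y \<in> pverts H" using e H.wellformed' by auto
    then obtain u v where "u \<in> pverts G" "v \<in> pverts G" "x = \<phi> u" "y = \<phi> v" using img by blast
    then show "e \<in> map_prod \<phi> \<phi> ` parcs G" using e arc xy by (intro image_eqI[of _ _ "(u, v)"]) auto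
  qed
  let ?iso = "\<lparr> iso_verts = \<phi>, iso_arcs = map_prod \<phi> \<phi>, iso_head = snd, iso_tail = fst \<rparr>"
  have "inj_on (map_prod \<phi> \<phi>) (parcs G)"
    using G.wellformed' by (intro inj_on_subset[OF map_prod_inj_on[OF inj inj]]) auto
  then have "G.digraph_isomorphism ?iso"
    unfolding G.digraph_isomorphism_def using inj by (auto intro: G.wf_digraph_axioms)
  moreover have "with_proj H = app_iso ?iso (with_proj G)"
    unfolding app_iso_def with_proj_def using img arcs by simp
  ultimately show ?thesis unfolding digraph_iso_def by blast
qed

text \<open>
  The distance of \<open>u\<close> and \<open>v\<close> in a graph with \<^const>\<open>split_join\<close> structure, as a function of
  \<open>A\<close> and \<open>T\<close> alone. It is used on the vertex set of a graph without that structure, too.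
\<close>

definition split_dist :: "'a set \<Rightarrow> 'a set \<Rightarrow> 'a \<Rightarrow> 'a \<Rightarrow> real" where
  "split_dist A T u v =
     (if u = v then 0 else if u \<in> A \<or> v \<in> A \<or> u \<notin> T \<and> v \<notin> T then 1 else 2)"

lemma split_join_connected:
  assumes G: "split_join G A T" and "A \<noteq> {}"
  shows "Digraph_Component.connected (with_proj G)"
proof -
  interpret pair_graph G using G by (simp add: split_join_def)
  obtain w where w: "w \<in> A" "w \<in> pverts G" using assms by (auto simp: split_join_def)
  have near: "reachable (with_proj G) u w" "reachable (with_proj G) w u" if "u \<in> pverts G" for u
    using G w that unfolding split_join_def
    by (cases "u = w"; auto intro!: adj_reachable_trans)+
  have "reachable (with_proj G) u v" if "u \<in> pverts G" "v \<in> pverts G" for u v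
    using near that reachable_trans by blast
  then have "reachable (with_proj (mk_symmetric (with_proj G))) u v"
    if "u \<in> pverts G" "v \<in> pverts G" for u v
    using that reachable_mk_symmetricI by blast
  then show ?thesis
    using w unfolding Digraph_Component.connected_def strongly_connected_def by auto
qed

lemma split_join_dist:
  assumes G: "split_join G A T" and A: "A \<noteq> {}" and uv: "u \<in> pverts G" "v \<in> pverts G"
  shows "real (graph_dist G u v) = split_dist A T u v"
proof -
  have pg: "pair_graph G" using G by (simp add: split_join_def)
  note conn = split_join_connected[OF G A]
  show ?thesis
  proof (cases "u = v")
    case True
    then show ?thesis using graph_dist_refl[OF pg uv(1)] by (simp add: split_dist_def)
  next
    case neq: False
    show ?thesis
    proof (cases "(u, v) \<in> parcs G")
      case True
      then have "graph_dist G u v = 1"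
        using graph_dist_adjacent[OF pg] graph_dist_pos[OF pg conn uv neq] by (simp add: le_antisym)
      moreover have "split_dist A T u v = 1" using True G uv by (auto simp: split_join_def split_dist_def)
      ultimately show ?thesis by simp
    next
      case False
      obtain w where w: "w \<in> A" "w \<in> pverts G" using A G by (auto simp: split_join_def)
      have "u \<notin> A" "v \<notin> A" and d: "split_dist A T u v = 2"
        using False G uv neq by (auto simp: split_join_def split_dist_def)
      then have "(u, w) \<in> parcs G" "(w, v) \<in> parcs G"
        using w G uv by (auto simp: split_join_def)
      then have "graph_dist G u v = 2"
        using graph_dist_common_neighbour[OF pg _ _ neq] graph_dist_nonadjacent[OF pg conn uv neq False]
        by (simp add: le_antisym)
      then show ?thesis using d by simp
    qed
  qed
qed

lemma split_dist_row_sum: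
  assumes fin: "finite V" and sub: "A \<subseteq> V" "T \<subseteq> V" "A \<inter> T = {}" and u: "u \<in> V"
  shows "(\<Sum>v\<in>V. split_dist A T u v * f v) =
    (if u \<in> A then sum f A + sum f (V - A - T) + sum f T - f u
     else if u \<in> T then sum f A + 2 * sum f (V - A - T) + 2 * sum f T - 2 * f u
     else sum f A + sum f (V - A - T) + 2 * sum f T - f u)"
proof -
  let ?M = "V - A - T"
  let ?e = "\<lambda>v. if u \<in> A \<or> v \<in> A \<or> u \<notin> T \<and> v \<notin> T then 1 else 2 :: real"
  have parts: "(\<Sum>v\<in>V. F v) = sum F A + sum F ?M + sum F T" for F :: "'a \<Rightarrow> real"
  proof -
    have "sum F V = sum F (V - A - T) + sum F T + sum F A"
      using sum.subset_diff[OF sub(1) fin, of F] sum.subset_diff[of T "V - A" F] fin sub by auto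
    then show ?thesis by simp
  qed
  have "(\<Sum>v\<in>V. split_dist A T u v * f v) = (\<Sum>v\<in>V. ?e v * f v - (if v = u then ?e u * f u else 0))"
    by (intro sum.cong refl) (auto simp: split_dist_def)
  also have "\<dots> = (\<Sum>v\<in>V. ?e v * f v) - ?e u * f u"
    using fin u by (simp add: sum_subtractf)
  also have "(\<Sum>v\<in>V. ?e v * f v) = (\<Sum>v\<in>A. f v) + (if u \<in> T then 2 else 1) * sum f ?M
      + (if u \<in> A then 1 else 2) * sum f T"
  proof -
    have "(\<Sum>v\<in>A. ?e v * f v) = sum f A" by (intro sum.cong) auto
    moreover have "(\<Sum>v\<in>?M. ?e v * f v) = (if u \<in> T then 2 else 1) * sum f ?M"
      unfolding sum_distrib_left using sub by (intro sum.cong) auto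
    moreover have "(\<Sum>v\<in>T. ?e v * f v) = (if u \<in> A then 1 else 2) * sum f T"
      unfolding sum_distrib_left using sub by (intro sum.cong) auto
    ultimately show ?thesis unfolding parts by simp
  qed
  finally show ?thesis using sub by auto
qed

text \<open>
  The row sum of the distance matrix at \<open>u\<close> depends, apart from the term with \<open>f u\<close>, only on
  the part that contains \<open>u\<close>. So the Perron vector takes three values \<open>a\<close>, \<open>b\<close>, \<open>c\<close> on \<open>A\<close>, on
  the large clique and on \<open>T\<close>, and the eigenvector equation reduces to three scalar equations. The
  bound on \<open>l\<close> comes from the Rayleigh quotient of the all-ones vector.
\<close>

lemma split_join_perron:
  assumes G: "split_join G A T" and A: "A \<noteq> {}" and n2: "2 \<le> card (pverts G)"
  defines "l \<equiv> distance_spectral_radius G"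
    and "t \<equiv> real (card A)" and "r \<equiv> real (card T)" and "m \<equiv> real (card (pverts G - A - T))"
  obtains a b c where "0 < a" "0 < b" "0 < c"
    and "(l + 1) * a = t * a + m * b + r * c"
    and "(l + 1) * b = t * a + m * b + 2 * r * c"
    and "(l + 2) * c = t * a + 2 * m * b + 2 * r * c"
    and "real (card (pverts G)) - 1 \<le> l"
proof -
  interpret pair_graph G using G by (simp add: split_join_def)
  have pg: "pair_graph G" by unfold_locales
  note conn = split_join_connected[OF G A]
  note fin = pair_finite_verts
  let ?V = "pverts G"
  let ?M = "?V - A - T"
  have sub: "A \<subseteq> ?V" "T \<subseteq> ?V" "A \<inter> T = {}" using G by (auto simp: split_join_def)
  obtain f where pos: "\<And>u. u \<in> ?V \<Longrightarrow> 0 < f u"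
    and eig: "\<And>u. u \<in> ?V \<Longrightarrow> (\<Sum>v\<in>?V. real (graph_dist G u v) * f v) = l * f u"
    and max: "\<And>g. (\<Sum>u\<in>?V. \<Sum>v\<in>?V. real (graph_dist G u v) * g u * g v) \<le> l * (\<Sum>u\<in>?V. (g u)\<^sup>2)"
    using distance_spectral_radius_perron[OF pg conn] unfolding l_def by metis
  have "real (card ?V) * (real (card ?V) - 1) \<le> l * real (card ?V)"
  proof -
    have "real (card ?V) * (real (card ?V) - 1) = (\<Sum>u\<in>?V. \<Sum>v\<in>?V. 1 - (if v = u then 1 else 0))"
      using fin by (simp add: sum_subtractf)
    also have "\<dots> \<le> (\<Sum>u\<in>?V. \<Sum>v\<in>?V. real (graph_dist G u v) * 1 * 1)"
    proof (intro sum_mono)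
      fix u v assume "u \<in> ?V" "v \<in> ?V"
      then show "1 - (if v = u then 1 else 0) \<le> real (graph_dist G u v) * 1 * 1"
        using graph_dist_pos[OF pg conn, of u v] by auto
    qed
    also have "\<dots> \<le> l * (\<Sum>u\<in>?V. 1\<^sup>2)" by (rule max)
    finally show ?thesis by simp
  qed
  then have l: "real (card ?V) - 1 \<le> l" using n2 by (simp add: mult.commute)
  have row: "l * f u = (if u \<in> A then sum f A + sum f ?M + sum f T - f u
     else if u \<in> T then sum f A + 2 * sum f ?M + 2 * sum f T - 2 * f u
     else sum f A + sum f ?M + 2 * sum f T - f u)" if "u \<in> ?V" for u
  proof -
    have "l * f u = (\<Sum>v\<in>?V. split_dist A T u v * f v)"
      unfolding eig[OF that, symmetric] using split_join_dist[OF G A that] by (intro sum.cong) auto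
    then show ?thesis using split_dist_row_sum[OF fin sub that, of f] by simp
  qed
  define sA sM sT where "sA = sum f A" and "sM = sum f ?M" and "sT = sum f T"
  define a b c where "a = (sA + sM + sT) / (l + 1)" and "b = (sA + sM + 2 * sT) / (l + 1)"
    and "c = (sA + 2 * sM + 2 * sT) / (l + 2)"
  have lpos: "l + 1 > 0" "l + 2 > 0" using l n2 by linarith+
  have fA: "f u = a" if "u \<in> A" for u
    using row[of u] that sub lpos unfolding a_def sA_def sM_def sT_def by (auto simp: field_simps)
  have fT: "f u = c" if "u \<in> T" for u
  proof -
    have "u \<notin> A" "u \<in> ?V" using that sub by auto
    then have "(l + 2) * f u = sA + 2 * sM + 2 * sT"
      using row[of u] that by (simp add: sA_def sM_def sT_def algebra_simps)
    then show ?thesis using lpos by (simp add: c_def field_simps)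
  qed
  have fM: "f u = b" if "u \<in> ?M" for u
    using row[of u] that sub lpos unfolding b_def sA_def sM_def sT_def by (auto simp: field_simps)
  have s: "sA = t * a" "sM = m * b" "sT = r * c"
    unfolding sA_def sM_def sT_def t_def m_def r_def using fA fT fM by auto
  have "sA > 0" unfolding sA_def using pos A sub fin by (intro sum_pos) (auto intro: finite_subset)
  moreover have "sM \<ge> 0" "sT \<ge> 0"
    unfolding sM_def sT_def by (intro sum_nonneg less_imp_le pos; use sub in blast)+
  ultimately have "0 < a" "0 < b" "0 < c" unfolding a_def b_def c_def using lpos by auto
  moreover have "(l + 1) * a = t * a + m * b + r * c" "(l + 1) * b = t * a + m * b + 2 * (r * c)"
    "(l + 2) * c = t * a + 2 * (m * b) + 2 * (r * c)"
    unfolding s[symmetric] using lpos by (auto simp: a_def b_def c_def)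
  ultimately show thesis using that[of a b c] l by (simp add: mult.assoc)
qed

section \<open>Arranging a split join along a barrier\<close>

text \<open>
  Places the three parts of a split join with part sizes \<open>t\<close>, \<open>r\<close> and the rest onto a graph with a
  barrier \<open>S\<close> of size \<open>t + j\<close>. Choose \<open>A \<subseteq> S\<close>, let \<open>C\<close> be a largest label class, let \<open>T\<close>
  and \<open>U\<close> consist of one representative each of \<open>r\<close> and of \<open>j\<close> further classes, and let \<open>R\<close>
  contain the other vertices outside \<open>S\<close>. The number \<open>w\<close> counts the vertices of \<open>R\<close> that share a
  class with a representative in \<open>T\<close>.

  The first estimate bounds from below the nonadjacent ordered pairs inside \<open>V - A - T\<close>, which are
  at distance \<open>1\<close> in the split join. The second one bounds from above the adjacent pairs
  between \<open>T\<close> and \<open>V - A - T\<close>, which are at distance \<open>2\<close> there. With \<open>h = card C + card R\<close>,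
  each of the \<open>h\<close> vertices of \<open>C \<union> R\<close> accounts for \<open>j\<close> nonadjacent pairs, and \<open>j * (j - 1)\<close> ordered
  pairs lie inside \<open>U\<close>. A vertex counted by \<open>w\<close> is adjacent to at most one vertex of \<open>T\<close>,
  but it is also nonadjacent to all of \<open>C\<close>, and \<open>C\<close> has at least two elements because no class is
  larger; this is the source of the term \<open>4 * w\<close>.
\<close>

lemma barrier_arrangement:
  fixes V S :: "'a set" and \<kappa> :: "'a \<Rightarrow> 'b"
  assumes fin: "finite V" and S: "S \<subseteq> V"
    and lab: "\<And>x y. x \<in> V - S \<Longrightarrow> y \<in> V - S \<Longrightarrow> adj x y \<Longrightarrow> \<kappa> x = \<kappa> y"
    and many: "r + j + 1 \<le> card (\<kappa> ` (V - S))" and j: "card S = t + j"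
  obtains A T h w where "A \<subseteq> V" "T \<subseteq> V" "A \<inter> T = {}" "card A = t" "card T = r"
    and "\<And>x y. x \<in> T \<Longrightarrow> y \<in> T \<Longrightarrow> x \<noteq> y \<Longrightarrow> \<not> adj x y"
    and "1 \<le> h" "card (V - A - T) = h + 2 * j"
    and "2 * j * h + j * (j - 1) + 4 * w
      \<le> card {(x, y) \<in> (V - A - T) \<times> (V - A - T). x \<noteq> y \<and> \<not> adj x y}"
    and "card {(x, y) \<in> T \<times> (V - A - T). adj x y} \<le> r * j + w"
proof -
  define L where "L = \<kappa> ` (V - S)"
  define fib where "fib l = {x \<in> V - S. \<kappa> x = l}" for l
  have finL: "finite L" using fin by (simp add: L_def)
  have finfib: "finite (fib l)" for l using fin by (simp add: fib_def)
  have "L \<noteq> {}" using many unfolding L_def[symmetric] by auto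
  then have "Max ((\<lambda>l. card (fib l)) ` L) \<in> (\<lambda>l. card (fib l)) ` L" using finL by (intro Max_in) auto
  then obtain l0 where l0: "l0 \<in> L" "card (fib l0) = Max ((\<lambda>l. card (fib l)) ` L)" by auto
  have big: "card (fib l) \<le> card (fib l0)" if "l \<in> L" for l
    unfolding l0(2) using that finL by (intro Max_ge) auto
  define rep where "rep l = (SOME x. x \<in> V - S \<and> \<kappa> x = l)" for l
  have rep: "rep l \<in> V - S" "\<kappa> (rep l) = l" if "l \<in> L" for l
    using someI_ex[of "\<lambda>x. x \<in> V - S \<and> \<kappa> x = l"] that unfolding rep_def L_def by auto
  have injrep: "inj_on rep L" using rep(2) by (rule inj_on_inverseI)
  have "r \<le> card (L - {l0})" using many l0(1) finL by (simp add: L_def[symmetric])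
  then obtain LT where LT: "LT \<subseteq> L - {l0}" "card LT = r" "finite LT"
    by (rule obtain_subset_with_card_n)
  have "card (L - {l0} - LT) = card L - 1 - r"
    using LT finL l0(1) by (simp add: card_Diff_subset)
  then have "j \<le> card (L - {l0} - LT)" using many by (simp add: L_def[symmetric])
  then obtain LU where LU: "LU \<subseteq> L - {l0} - LT" "card LU = j" "finite LU"
    by (rule obtain_subset_with_card_n)
  obtain A where A: "A \<subseteq> S" "card A = t" "finite A" using j by (metis le_add1 obtain_subset_with_card_n)
  define T U C where "T = rep ` LT" and "U = rep ` LU" and "C = fib l0"
  define R where "R = V - S - T - U - C"
  define W where "W = {x \<in> R. \<kappa> x \<in> LT}"
  have labT: "\<kappa> x \<in> LT" "x \<in> V - S" "x = rep (\<kappa> x)" if x: "x \<in> T" for x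
  proof -
    obtain l where "x = rep l" "l \<in> LT" using x by (auto simp: T_def)
    then show "\<kappa> x \<in> LT" "x \<in> V - S" "x = rep (\<kappa> x)" using LT(1) rep[of l] by auto
  qed
  have labU: "\<kappa> x \<in> LU" "x \<in> V - S" "x = rep (\<kappa> x)" if x: "x \<in> U" for x
  proof -
    obtain l where "x = rep l" "l \<in> LU" using x by (auto simp: U_def)
    then show "\<kappa> x \<in> LU" "x \<in> V - S" "x = rep (\<kappa> x)" using LU(1) rep[of l] by auto
  qed
  have labC: "\<kappa> x = l0" "x \<in> V - S" if "x \<in> C" for x using that by (auto simp: C_def fib_def)
  have labR: "\<kappa> x \<in> L" "\<kappa> x \<noteq> l0" "x \<in> V - S" if "x \<in> R" for x
    using that unfolding R_def L_def C_def fib_def by auto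
  have disj: "T \<inter> U = {}" "T \<inter> C = {}" "U \<inter> C = {}"
    using labT(1) labU(1) labC(1) LT(1) LU(1) by blast+
  have fins: "finite T" "finite U" "finite C" "finite R" "finite W" "finite S"
    using LT(3) LU(3) finfib fin S unfolding T_def U_def C_def R_def W_def by (auto intro: finite_subset)
  have cardT: "card T = r" and cardU: "card U = j"
    unfolding T_def U_def LT(2)[symmetric] LU(2)[symmetric]
    by (intro card_image inj_on_subset[OF injrep]; use LT(1) LU(1) in blast)+
  have C1: "1 \<le> card C"
  proof -
    have "rep l0 \<in> C" using rep[OF l0(1)] by (simp add: C_def fib_def)
    then show ?thesis using fins(3) by (simp add: Suc_le_eq card_gt_0_iff) blast
  qed
  have C2: "2 \<le> card C" if "x \<in> R" "\<kappa> x \<in> LT \<union> LU" for x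
  proof -
    have "rep (\<kappa> x) \<in> T \<union> U" using that(2) by (auto simp: T_def U_def)
    then have "rep (\<kappa> x) \<noteq> x" using that(1) by (auto simp: R_def)
    moreover have "{x, rep (\<kappa> x)} \<subseteq> fib (\<kappa> x)"
      using labR[OF that(1)] rep[of "\<kappa> x"] by (auto simp: fib_def)
    then have "card {x, rep (\<kappa> x)} \<le> card (fib (\<kappa> x))" using finfib by (rule card_mono[rotated])
    ultimately have "2 \<le> card (fib (\<kappa> x))" by simp
    then show ?thesis using big[OF labR(1)[OF that(1)]] by (simp add: C_def)
  qed
  define M where "M = V - A - T"
  have M: "M = (S - A) \<union> U \<union> C \<union> R"
    using A(1) S labT(2) labU(2) labC(2) disj unfolding M_def R_def by blast
  have cardM: "card M = (card C + card R) + 2 * j"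
  proof -
    have "card (S - A) = j" using A j by (simp add: card_Diff_subset)
    moreover have "(S - A) \<inter> U = {}" "((S - A) \<union> U) \<inter> C = {}" "((S - A) \<union> U \<union> C) \<inter> R = {}"
      using labU(2) labC(2) disj unfolding R_def by blast+
    ultimately show ?thesis unfolding M using fins cardU by (simp add: card_Un_disjoint)
  qed
  \<comment> \<open>\<open>X x\<close> contains the partners in \<open>U \<union> C\<close> that are certainly nonadjacent to \<open>x \<in> R\<close>; the pairs
    in \<open>B\<close> are counted once here and once more in the converse relation.\<close>
  define X where "X x = {y \<in> U \<union> C. \<kappa> y \<noteq> \<kappa> x}" for x
  have cardX: "j + (if x \<in> W then 2 else 0) \<le> card (X x)" if x: "x \<in> R" for x
  proof -
    have "(U - {rep (\<kappa> x)}) \<union> C \<subseteq> X x"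
    proof
      fix y assume y: "y \<in> (U - {rep (\<kappa> x)}) \<union> C"
      then have "\<kappa> y \<noteq> \<kappa> x" using labU(3)[of y] labC(1)[of y] labR(2)[OF x] by auto
      then show "y \<in> X x" using y by (auto simp: X_def)
    qed
    then have "card ((U - {rep (\<kappa> x)}) \<union> C) \<le> card (X x)"
      using fins by (intro card_mono) (auto simp: X_def)
    moreover have "card ((U - {rep (\<kappa> x)}) \<union> C) = card (U - {rep (\<kappa> x)}) + card C"
      using disj fins by (intro card_Un_disjoint) auto
    moreover have "j \<le> card (U - {rep (\<kappa> x)}) + (if \<kappa> x \<in> LU then 1 else 0)"
    proof (cases "\<kappa> x \<in> LU")
      case True
      then show ?thesis using cardU fins(2) by (simp add: card_Diff_singleton_if) arith
    next
      case False
      then have "rep (\<kappa> x) \<notin> U" using labU(1)[of "rep (\<kappa> x)"] rep(2)[OF labR(1)[OF x]] by auto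
      then show ?thesis using cardU by simp
    qed
    moreover have "\<kappa> x \<notin> LU" if "x \<in> W" using that LU(1) by (auto simp: W_def)
    moreover have "\<kappa> x \<in> LT" if "x \<in> W" using that by (auto simp: W_def)
    ultimately show ?thesis using C1 C2[OF x] by (auto split: if_splits)
  qed
  define B where "B = U \<times> C \<union> Sigma R X"
  define D where "D = (SIGMA u:U. U - {u})"
  define NU where "NU = {(x, y) \<in> M \<times> M. x \<noteq> y \<and> \<not> adj x y}"
  have finB: "finite B" and finD: "finite D" unfolding B_def D_def X_def using fins by auto
  have cardB: "j * (card C + card R) + 2 * card W \<le> card B"
  proof -
    have "R \<inter> U = {}" by (auto simp: R_def)
    then have "card B = card (U \<times> C) + card (Sigma R X)"
      unfolding B_def X_def using fins by (intro card_Un_disjoint) auto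
    also have "card (Sigma R X) = (\<Sum>x\<in>R. card (X x))"
      using fins by (intro card_SigmaI) (auto simp: X_def)
    finally have "card B = card (U \<times> C) + (\<Sum>x\<in>R. card (X x))" .
    moreover have "(\<Sum>x\<in>R. j + (if x \<in> W then 2 else 0)) \<le> (\<Sum>x\<in>R. card (X x))"
      using cardX by (intro sum_mono)
    ultimately have "card (U \<times> C) + (\<Sum>x\<in>R. j + (if x \<in> W then 2 else 0)) \<le> card B" by simp
    moreover have "(\<Sum>x\<in>R. if x \<in> W then 2 else (0::nat)) = 2 * card W"
    proof -
      have "(\<Sum>x\<in>R. if x \<in> W then 2 else (0::nat)) = (\<Sum>x\<in>R \<inter> W. 2)"
        using sum.inter_restrict[OF fins(4), of "\<lambda>_. 2::nat" W] by simp
      also have "R \<inter> W = W" by (auto simp: W_def)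
      finally show ?thesis by simp
    qed
    ultimately show ?thesis using cardU by (simp add: sum.distrib card_cartesian_product algebra_simps)
  qed
  have cardD: "card D = j * (j - 1)"
    unfolding D_def using fins(2) cardU by (simp add: card_Diff_singleton_if)
  have sub: "B \<union> B\<inverse> \<union> D \<subseteq> NU"
  proof -
    have nadj: "x \<in> M \<and> y \<in> M \<and> x \<noteq> y \<and> \<not> adj x y \<and> \<not> adj y x"
      if "x \<in> U \<union> C \<union> R" "y \<in> U \<union> C \<union> R" "\<kappa> x \<noteq> \<kappa> y" for x y
    proof -
      have "x \<in> V - S" "y \<in> V - S" using that(1,2) labU(2) labC(2) labR(3) by blast+
      then show ?thesis using that lab[of x y] lab[of y x] unfolding M by auto
    qed
    have UC: "\<kappa> x \<noteq> \<kappa> y" if "x \<in> U" "y \<in> C" for x y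
      using labU(1)[OF that(1)] labC(1)[OF that(2)] LU(1) by auto
    have UU: "\<kappa> x \<noteq> \<kappa> y" if "x \<in> U" "y \<in> U" "x \<noteq> y" for x y
      using labU(3)[OF that(1)] labU(3)[OF that(2)] that(3) by auto
    have both: "(x, y) \<in> NU \<and> (y, x) \<in> NU"
      if "x \<in> U \<union> C \<union> R" "y \<in> U \<union> C \<union> R" "\<kappa> x \<noteq> \<kappa> y" for x y
      using nadj[OF that] by (auto simp: NU_def)
    have "(x, y) \<in> NU \<and> (y, x) \<in> NU" if "(x, y) \<in> B" for x y
      using that UC[of x y] both[of x y] unfolding B_def X_def by auto
    moreover have "(x, y) \<in> NU" if "(x, y) \<in> D" for x y
      using that UU[of x y] both[of x y] unfolding D_def by auto
    ultimately show ?thesis by auto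
  qed
  have "card (B \<union> B\<inverse> \<union> D) = 2 * card B + card D"
  proof -
    have 1: "B \<inter> B\<inverse> = {}" "(B \<union> B\<inverse>) \<inter> D = {}"
      using disj unfolding B_def D_def X_def R_def by auto
    have "card (B\<inverse>) = card B" by simp
    then show ?thesis using 1 finB finD by (simp add: card_Un_disjoint)
  qed
  moreover have "card (B \<union> B\<inverse> \<union> D) \<le> card NU"
    using sub fin by (intro card_mono) (auto simp: NU_def M_def intro: finite_subset[of _ "V \<times> V"])
  ultimately have nu: "2 * j * (card C + card R) + j * (j - 1) + 4 * card W \<le> card NU"
    using cardB unfolding cardD mult.assoc by linarith
  have "{(x, y) \<in> T \<times> M. adj x y} \<subseteq> T \<times> (S - A) \<union> (\<lambda>y. (rep (\<kappa> y), y)) ` W"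
  proof clarify
    fix x y assume xy: "x \<in> T" "y \<in> M" "adj x y" and nW: "(x, y) \<notin> (\<lambda>y. (rep (\<kappa> y), y)) ` W"
    show "y \<in> S - A"
    proof (rule ccontr)
      assume "y \<notin> S - A"
      then have y: "y \<in> V - S" "y \<notin> T" using xy(2) A(1) by (auto simp: M_def)
      have k: "\<kappa> x = \<kappa> y" using lab[OF labT(2)[OF xy(1)] y(1) xy(3)] .
      then have yLT: "\<kappa> y \<in> LT" using labT(1)[OF xy(1)] by simp
      then have "y \<notin> U" "y \<notin> C" using labU(1) labC(1) LU(1) LT(1) by blast+
      then have "y \<in> W" using y yLT by (simp add: W_def R_def)
      moreover have "(x, y) = (rep (\<kappa> y), y)" using labT(3)[OF xy(1)] unfolding k by simp
      ultimately have "(x, y) \<in> (\<lambda>y. (rep (\<kappa> y), y)) ` W" by (rule image_eqI[rotated])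
      then show False using nW by contradiction
    qed
  qed
  then have "card {(x, y) \<in> T \<times> M. adj x y} \<le> card (T \<times> (S - A) \<union> (\<lambda>y. (rep (\<kappa> y), y)) ` W)"
    using fins by (intro card_mono) auto
  also have "\<dots> \<le> card (T \<times> (S - A)) + card ((\<lambda>y. (rep (\<kappa> y), y)) ` W)" by (rule card_Un_le)
  also have "\<dots> \<le> r * j + card W"
  proof -
    have "card (S - A) = j" using A j by (simp add: card_Diff_subset)
    then show ?thesis using cardT card_image_le[OF fins(5)] by (simp add: card_cartesian_product)
  qed
  finally have alpha: "card {(x, y) \<in> T \<times> M. adj x y} \<le> r * j + card W" .
  have "\<not> adj x y" if "x \<in> T" "y \<in> T" "x \<noteq> y" for x y
  proof
    assume "adj x y"
    then have "\<kappa> x = \<kappa> y" using lab labT(2) that(1,2) by blast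
    then have "rep (\<kappa> x) = rep (\<kappa> y)" by simp
    then show False using labT(3)[OF that(1)] labT(3)[OF that(2)] that(3) by simp
  qed
  moreover have "T \<subseteq> V" "A \<inter> T = {}" "A \<subseteq> V" using labT(2) A(1) S by blast+
  ultimately show thesis
    using that[of A T "card C + card R" "card W"] A(2) cardT C1 cardM nu alpha
    unfolding NU_def M_def by simp
qed

section \<open>Comparing the quadratic forms\<close>

text \<open>
  Let \<open>y\<close> be the vector with values \<open>a\<close>, \<open>b\<close>, \<open>c\<close> on \<open>A\<close>, \<open>V - A - T\<close>, \<open>T\<close>. The three equations
  say that \<open>y\<close> is an eigenvector of \<^const>\<open>split_dist\<close> for \<open>l\<close>. Replacing \<^const>\<open>split_dist\<close> by the
  distances of \<open>G\<close> changes the quadratic form at \<open>y\<close> by at least \<open>b\<^sup>2\<close> for each pair in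
  \<open>NU\<close> and by at least \<open>- 2 b c\<close> for each pair in \<open>AD\<close>, and it never decreases it anywhere else.
  If the total change is positive, the Rayleigh quotient of \<open>G\<close> at \<open>y\<close> exceeds \<open>l\<close>. When \<open>AD\<close> is
  empty, one additional nonadjacent pair suffices.
\<close>

lemma distance_spectral_radius_gt_split:
  assumes G: "pair_graph G" and conn: "Digraph_Component.connected (with_proj G)"
    and sub: "A \<subseteq> pverts G" "T \<subseteq> pverts G" "A \<inter> T = {}"
    and indep: "\<And>x y. x \<in> T \<Longrightarrow> y \<in> T \<Longrightarrow> x \<noteq> y \<Longrightarrow> (x, y) \<notin> parcs G"
    and pos: "0 < a" "0 < b" "0 < c"
    and eqA: "(l + 1) * a = real (card A) * a + real (card (pverts G - A - T)) * b + real (card T) * c"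
    and eqM: "(l + 1) * b = real (card A) * a + real (card (pverts G - A - T)) * b + 2 * real (card T) * c"
    and eqT: "(l + 2) * c = real (card A) * a + 2 * real (card (pverts G - A - T)) * b + 2 * real (card T) * c"
    and AD: "AD = {(x, y) \<in> T \<times> (pverts G - A - T). (x, y) \<in> parcs G}"
    and NU: "NU = {(x, y) \<in> (pverts G - A - T) \<times> (pverts G - A - T). x \<noteq> y \<and> (x, y) \<notin> parcs G}"
    and gain: "2 * c * real (card AD) < b * real (card NU) \<or>
      AD = {} \<and> (\<exists>u\<in>pverts G. \<exists>v\<in>pverts G. u \<noteq> v \<and> (u, v) \<notin> parcs G \<and> split_dist A T u v = 1)"
  shows "l < distance_spectral_radius G"
proof -
  interpret pair_graph G by fact
  note fin = pair_finite_verts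
  let ?V = "pverts G"
  let ?M = "?V - A - T"
  let ?d = "\<lambda>u v. real (graph_dist G u v)"
  define y where "y u = (if u \<in> A then a else if u \<in> T then c else b)" for u
  define F where "F = (\<lambda>(u, v). (?d u v - split_dist A T u v) * y u * y v)"
  have ypos: "0 < y u" for u using pos by (simp add: y_def)
  have "sum y A = real (card A) * a" by (simp add: y_def)
  moreover have "sum y T = real (card T) * c"
  proof -
    have "sum y T = (\<Sum>u\<in>T. c)" using sub by (intro sum.cong) (auto simp: y_def)
    then show ?thesis by simp
  qed
  moreover have "sum y ?M = real (card ?M) * b" by (simp add: y_def)
  ultimately have row: "(\<Sum>v\<in>?V. split_dist A T u v * y v) = l * y u" if "u \<in> ?V" for u
    unfolding split_dist_row_sum[OF fin sub that]
    using eqA eqM eqT sub by (auto simp: y_def algebra_simps)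
  have "(\<Sum>u\<in>?V. \<Sum>v\<in>?V. split_dist A T u v * y u * y v) = (\<Sum>u\<in>?V. y u * (\<Sum>v\<in>?V. split_dist A T u v * y v))"
    by (simp add: sum_distrib_left algebra_simps)
  also have "\<dots> = l * (\<Sum>u\<in>?V. (y u)\<^sup>2)"
    unfolding sum_distrib_left[of l] by (intro sum.cong refl) (simp add: row power2_eq_square)
  finally have split: "(\<Sum>u\<in>?V. \<Sum>v\<in>?V. split_dist A T u v * y u * y v) = l * (\<Sum>u\<in>?V. (y u)\<^sup>2)" .
  have dist: "(if u = v then 0 else if (u, v) \<in> parcs G then 1 else 2) \<le> ?d u v"
    if "u \<in> ?V" "v \<in> ?V" for u v
    using graph_dist_pos[OF G conn that] graph_dist_nonadjacent[OF G conn that] by auto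
  have Fge: "F (u, v) \<ge> ((if u = v then 0 else if (u, v) \<in> parcs G then 1 else 2) - split_dist A T u v) * (y u * y v)"
    if "u \<in> ?V" "v \<in> ?V" for u v
  proof -
    have "0 \<le> y u * y v" using ypos[of u] ypos[of v] by simp
    then show ?thesis
      unfolding F_def using mult_right_mono[OF diff_right_mono[OF dist[OF that], of "split_dist A T u v"]]
      by (simp add: mult.assoc)
  qed
  have "0 < sum F (?V \<times> ?V)"
  proof (cases "2 * c * real (card AD) < b * real (card NU)")
    case True
    have point: "(if p \<in> NU then b * b else 0) - (if p \<in> AD then b * c else 0)
        - (if p \<in> AD\<inverse> then b * c else 0) \<le> F p" if "p \<in> ?V \<times> ?V" for p
    proof -
      obtain u v where p: "p = (u, v)" by fastforce
      have uv: "u \<in> ?V" "v \<in> ?V" using that p by auto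
      have bc: "0 < b * b" "0 < b * c" "0 < c * c" "0 < a * b" "0 < a * c" "0 < a * a" using pos by simp_all
      have sym: "(u, v) \<in> parcs G \<longleftrightarrow> (v, u) \<in> parcs G" using arcs_symmetric by blast
      have "(if p \<in> NU then b * b else 0) - (if p \<in> AD then b * c else 0) - (if p \<in> AD\<inverse> then b * c else 0)
        \<le> ((if u = v then 0 else if (u, v) \<in> parcs G then 1 else 2) - split_dist A T u v) * (y u * y v)"
      proof (cases "u = v")
        case True
        then show ?thesis using p bc by (auto simp: split_dist_def NU AD)
      next
        case False
        show ?thesis
        proof (cases "u \<in> A \<or> v \<in> A")
          case True
          moreover have "0 \<le> y u * y v" using ypos[of u] ypos[of v] by simp
          moreover have "p \<notin> NU" "p \<notin> AD" "p \<notin> AD\<inverse>" using True p sub by (auto simp: NU AD)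
          ultimately show ?thesis using False by (auto simp: split_dist_def)
        next
          case nA: False
          show ?thesis
          proof (cases "u \<in> T"; cases "v \<in> T")
            assume "u \<in> T" "v \<in> T"
            then show ?thesis using False nA p indep[of u v] by (auto simp: split_dist_def NU AD)
          next
            assume "u \<in> T" "v \<notin> T"
            then show ?thesis using False nA p uv bc by (auto simp: split_dist_def NU AD y_def mult.commute)
          next
            assume "u \<notin> T" "v \<in> T"
            then show ?thesis using False nA p uv bc sym by (auto simp: split_dist_def NU AD y_def)
          next
            assume "u \<notin> T" "v \<notin> T"
            then show ?thesis using False nA p uv bc by (auto simp: split_dist_def NU AD y_def)
          qed
        qed
      qed
      also have "\<dots> \<le> F p" using Fge[OF uv] p by simp
      finally show ?thesis .
    qed
    have count: "(\<Sum>p\<in>?V \<times> ?V. if p \<in> Z then x else 0) = real (card Z) * x" if "Z \<subseteq> ?V \<times> ?V" for Z x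
    proof -
      have "(\<Sum>p\<in>?V \<times> ?V. if p \<in> Z then x else 0) = (\<Sum>p\<in>(?V \<times> ?V) \<inter> Z. x)"
        using sum.inter_restrict[of "?V \<times> ?V" "\<lambda>_. x" Z] fin by simp
      then show ?thesis using that by (simp add: Int_absorb1)
    qed
    have inV: "NU \<subseteq> ?V \<times> ?V" "AD \<subseteq> ?V \<times> ?V" "AD\<inverse> \<subseteq> ?V \<times> ?V" using sub by (auto simp: NU AD)
    have "real (card NU) * (b * b) - real (card AD) * (b * c) - real (card AD) * (b * c) \<le> sum F (?V \<times> ?V)"
    proof -
      have "(\<Sum>p\<in>?V \<times> ?V. (if p \<in> NU then b * b else 0) - (if p \<in> AD then b * c else 0)
        - (if p \<in> AD\<inverse> then b * c else 0)) \<le> sum F (?V \<times> ?V)"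
        using point by (rule sum_mono)
      then show ?thesis unfolding sum_subtractf count[OF inV(1)] count[OF inV(2)] count[OF inV(3)] by simp
    qed
    moreover have "b * (2 * c * real (card AD)) < b * (b * real (card NU))"
      using True pos by (intro mult_strict_left_mono) auto
    ultimately show ?thesis by (simp add: algebra_simps)
  next
    case False
    then obtain u0 v0 where AD0: "AD = {}" and uv0: "u0 \<in> ?V" "v0 \<in> ?V" "u0 \<noteq> v0" "(u0, v0) \<notin> parcs G"
      "split_dist A T u0 v0 = 1" using gain by blast
    have nadj: "(u, v) \<notin> parcs G" if "u \<in> T" "v \<in> ?M" for u v using AD0 that by (auto simp: AD)
    show ?thesis
    proof (rule sum_pos2)
      show "finite (?V \<times> ?V)" using fin by simp
      show "(u0, v0) \<in> ?V \<times> ?V" using uv0 by simp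
      have "0 < y u0 * y v0" using ypos[of u0] ypos[of v0] by simp
      then show "0 < F (u0, v0)" using Fge[OF uv0(1,2)] uv0(3-5) by simp
      fix p assume "p \<in> ?V \<times> ?V"
      then obtain u v where p: "p = (u, v)" "u \<in> ?V" "v \<in> ?V" by auto
      have "0 \<le> (if u = v then 0 else if (u, v) \<in> parcs G then 1 else 2) - split_dist A T u v"
        using nadj[of u v] nadj[of v u] indep[of u v] arcs_symmetric[of u v] p by (auto simp: split_dist_def)
      moreover have "0 \<le> y u * y v" using ypos[of u] ypos[of v] by simp
      ultimately have "0 \<le> ((if u = v then 0 else if (u, v) \<in> parcs G then 1 else 2)
        - split_dist A T u v) * (y u * y v)" by (rule mult_nonneg_nonneg)
      then show "0 \<le> F p" unfolding p(1) by (rule order_trans[OF _ Fge[OF p(2,3)]])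
    qed
  qed
  also have "sum F (?V \<times> ?V) = (\<Sum>u\<in>?V. \<Sum>v\<in>?V. ?d u v * y u * y v) - l * (\<Sum>u\<in>?V. (y u)\<^sup>2)"
    unfolding split[symmetric] F_def sum.cartesian_product[symmetric] sum_subtractf[symmetric]
    by (intro sum.cong refl) (simp add: algebra_simps)
  finally have "l * (\<Sum>u\<in>?V. (y u)\<^sup>2) < (\<Sum>u\<in>?V. \<Sum>v\<in>?V. ?d u v * y u * y v)" by simp
  also have "\<dots> \<le> distance_spectral_radius G * (\<Sum>u\<in>?V. (y u)\<^sup>2)"
    by (rule rayleigh_le_distance_spectral_radius[OF G conn])
  finally show ?thesis by (rule mult_right_less_imp_less) (simp add: sum_nonneg)
qed

text \<open>
  The first hypothesis says \<open>c / b = (l + 1 + m) / (l + 2)\<close>, which lies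
  below \<open>2\<close>. The second claim has little room: as \<open>2 * (2 * h + j - 1) \<ge> m + 1\<close>, it is enough that
  \<open>4 r (l + 1 + m) < (m + 1) (l + 2)\<close>. Here \<open>m + 1 > 4 r\<close>, so the inequality is hardest at the
  smallest possible \<open>l\<close>, and after that at the smallest possible \<open>m\<close>, namely \<open>8 r - 2\<close>. This
  bound on \<open>m\<close> is what the order of the graph is required to guarantee.
\<close>

lemma weight_ratio:
  fixes l b c t r m h j :: real
  assumes c: "(l + 2) * c = (l + 1 + m) * b" and b: "0 < b"
    and m: "m = h + 2 * j" and h: "1 \<le> h" and t: "1 \<le> t" and r: "2 \<le> r"
    and l: "t + m + r - 1 \<le> l" and large: "8 * r - 2 \<le> m"
  shows "c < 2 * b" and "2 * r * c < (2 * h + j - 1) * b"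
proof -
  have l2: "0 < l + 2" using l t r large by linarith
  have "(l + 2) * c < (l + 2) * (2 * b)"
  proof -
    have "m + 2 \<le> l" using l t r by linarith
    then have "l + 1 + m < 2 * (l + 2)" by simp
    then have "(l + 1 + m) * b < (2 * (l + 2)) * b" using b by (rule mult_strict_right_mono)
    then show ?thesis unfolding c by (simp add: algebra_simps)
  qed
  then show "c < 2 * b" using l2 by (simp add: mult_less_cancel_left)
  \<comment> \<open>At \<open>l + 2 = m + t + r + 1\<close>, the smallest value, the claim is quadratic in \<open>p = m + 1\<close>.\<close>
  define p where "p = m + 1"
  have p: "8 * r - 1 \<le> p" using large by (simp add: p_def)
  have "4 * r * (t + r - 2) < (8 * r - 1) * (r + t - 1)"
  proof -
    have "(8 * r - 1) * (r + t - 1) - 4 * r * (t + r - 2) = (4 * r - 1) * (r + t - 1) + 4 * r"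
      by (simp add: algebra_simps)
    moreover have "0 \<le> (4 * r - 1) * (r + t - 1)" using r t by (intro mult_nonneg_nonneg) auto
    ultimately show ?thesis using r by linarith
  qed
  also have "\<dots> \<le> p * (p + t - 7 * r)" using p r t by (intro mult_mono) auto
  finally have "4 * r * (p - 2) < (p - 4 * r) * (p + t + r)" by (simp add: algebra_simps)
  also have "\<dots> \<le> (p - 4 * r) * (l + 2)" using p r l by (intro mult_left_mono) (auto simp: p_def)
  finally have "4 * r * (l + 1 + m) < (m + 1) * (l + 2)" by (simp add: p_def algebra_simps)
  also have "\<dots> \<le> (2 * (2 * h + j - 1)) * (l + 2)" using m h l2 by (intro mult_right_mono) auto
  finally have "2 * r * (l + 1 + m) < (2 * h + j - 1) * (l + 2)" by (simp add: algebra_simps)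
  then have "2 * r * (l + 1 + m) * b < (2 * h + j - 1) * (l + 2) * b"
    using b by (rule mult_strict_right_mono)
  moreover have "2 * r * (l + 1 + m) * b = 2 * r * ((l + 2) * c)" unfolding c by simp
  ultimately have "(l + 2) * (2 * r * c) < (l + 2) * ((2 * h + j - 1) * b)" by (simp add: algebra_simps)
  then show "2 * r * c < (2 * h + j - 1) * b" using l2 by (simp add: mult_less_cancel_left)
qed

section \<open>Matching number and distance spectral radius\<close>

theorem theorem3p2:
  fixes n t k :: nat and G :: "'a pair_pre_digraph"
  assumes "2 \<le> k" and "k \<le> n - 2"
    and "1 \<le> t" and "real t \<le> (real n - real k) / 2"
    and "[n = k] (mod 2)"
    and "pair_graph G" and "Digraph_Component.connected (with_proj G)"
    and "t_connected t G"
    and "card (pverts G) = n"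
    and "n \<ge> 9 * k + 10 * t - 11"
    and "distance_spectral_radius G \<le> distance_spectral_radius (extremal_graph n t k)"
  shows "real (matching_number G) > (real n - real k) / 2
    \<or> digraph_iso (with_proj G) (with_proj (extremal_graph n t k))"
proof (cases "(real n - real k) / 2 < real (matching_number G)")
  case False
  then have "2 * real (matching_number G) + real k \<le> real n" by (simp add: field_simps)
  then have small: "2 * matching_number G + k \<le> n" by linarith
  note k2 = assms(1) and t1 = assms(3) and pg = assms(6) and conn = assms(7) and card_n = assms(9)
  interpret pair_graph G by (fact pg)
  let ?V = "pverts G"
  have edge: "{x, y} \<in> edge_set G \<longleftrightarrow> (x, y) \<in> parcs G" for x y
    unfolding edge_set_def using arcs_symmetric by (auto simp: doubleton_eq_iff)
  have edge2: "card e = 2" if "e \<in> edge_set G" for e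
    using that no_loops' unfolding edge_set_def by fastforce
  have edgeV: "e \<subseteq> ?V" if "e \<in> edge_set G" for e
    using that wellformed' unfolding edge_set_def by fastforce
  have "2 * card M + k \<le> card ?V" if M: "matching_in (edge_set G) ?V M" for M
  proof -
    have "{M. is_matching G M} \<subseteq> Pow (Pow ?V)" using edgeV by (auto simp: is_matching_def)
    then have "finite (card ` {M. is_matching G M})"
      using pair_finite_verts by (meson finite_Pow_iff finite_imageI finite_subset)
    moreover have "is_matching G M" using M by (simp add: is_matching_def matching_in_def)
    ultimately have "card M \<le> matching_number G"
      unfolding matching_number_def by (intro Max_ge) auto
    then show ?thesis using small card_n by simp
  qed
  \<comment> \<open>A barrier exists because the matching number is too small for the order.\<close>
  then obtain S and \<kappa> :: "'a \<Rightarrow> 'a set" where S: "S \<subseteq> ?V"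
    and lab: "\<forall>u\<in>?V - S. \<forall>v\<in>?V - S. {u, v} \<in> edge_set G \<longrightarrow> \<kappa> u = \<kappa> v"
    and many: "card S + k \<le> card (\<kappa> ` (?V - S))"
    using berge_barrier[of ?V "edge_set G" k] pair_finite_verts edge2 by blast
  have labG: "\<kappa> x = \<kappa> y" if "x \<in> ?V - S" "y \<in> ?V - S" "(x, y) \<in> parcs G" for x y
    using lab[unfolded edge] that by blast
  have "2 \<le> card (\<kappa> ` (?V - S))" using many k2 by linarith
  then obtain Q where Q: "Q \<subseteq> \<kappa> ` (?V - S)" "card Q = 2" by (rule obtain_subset_with_card_n)
  obtain p q where "Q = {p, q}" "p \<noteq> q" using Q(2) unfolding card_2_iff by (elim exE conjE)
  then have pq: "p \<in> \<kappa> ` (?V - S)" "q \<in> \<kappa> ` (?V - S)" "p \<noteq> q" using Q(1) by blast+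
  obtain x where x: "x \<in> ?V - S" "p = \<kappa> x" using pq(1) by (rule imageE)
  obtain y where y: "y \<in> ?V - S" "q = \<kappa> y" using pq(2) by (rule imageE)
  have "connectivity G \<le> card S"
  proof (rule connectivity_le_card_separator[OF pg S, where \<kappa> = \<kappa>])
    show "x \<in> ?V - S" "y \<in> ?V - S" "\<kappa> x \<noteq> \<kappa> y" using x y pq(3) by simp_all
  qed (rule labG)
  then have "t \<le> card S" using assms(8) by (simp add: t_connected_def)
  then obtain j where j: "card S = t + j" by (auto simp: le_iff_add)
  define r where "r = t + k - 1"
  have r: "2 \<le> r" "r + j + 1 \<le> card (\<kappa> ` (?V - S))"
    using many j k2 t1 unfolding r_def by linarith+
  obtain A T h w where sub: "A \<subseteq> ?V" "T \<subseteq> ?V" "A \<inter> T = {}" and cards: "card A = t" "card T = r"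
    and indep: "\<And>x y. x \<in> T \<Longrightarrow> y \<in> T \<Longrightarrow> x \<noteq> y \<Longrightarrow> (x, y) \<notin> parcs G"
    and h: "1 \<le> h" and cardM: "card (?V - A - T) = h + 2 * j"
    and nu: "2 * j * h + j * (j - 1) + 4 * w
      \<le> card {(x, y) \<in> (?V - A - T) \<times> (?V - A - T). x \<noteq> y \<and> (x, y) \<notin> parcs G}"
    and alpha: "card {(x, y) \<in> T \<times> (?V - A - T). (x, y) \<in> parcs G} \<le> r * j + w"
  proof (rule barrier_arrangement[of ?V S "\<lambda>x y. (x, y) \<in> parcs G" \<kappa> r j t])
    show "\<kappa> x = \<kappa> y" if "x \<in> ?V - S" "y \<in> ?V - S" "(x, y) \<in> parcs G" for x y
      using that by (rule labG)
  qed (rule pair_finite_verts, rule S, rule r(2), rule j, rule that)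
  define m where "m = h + 2 * j"
  define AD where "AD = {(x, y) \<in> T \<times> (?V - A - T). (x, y) \<in> parcs G}"
  define NU where "NU = {(x, y) \<in> (?V - A - T) \<times> (?V - A - T). x \<noteq> y \<and> (x, y) \<notin> parcs G}"
  have fin: "finite A" "finite T" using sub pair_finite_verts by (auto intro: finite_subset)
  have nsum: "n = t + r + m"
    using card_parts[OF pair_finite_verts sub] cards cardM card_n by (simp add: m_def)
  let ?E = "extremal_graph n t k"
  let ?B = "Inl ` {..<t} :: (nat + nat + nat \<times> nat) set"
  let ?U = "(\<lambda>i. Inr (Inr (i, 0))) ` {..<t + k - 1} :: (nat + nat + nat \<times> nat) set"
  have E: "split_join ?E ?B ?U" by (rule split_join_extremal_graph)
  have cardE: "card (pverts ?E) = n"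
    using nsum t1 k2 h by (intro card_pverts_extremal_graph) (auto simp: r_def m_def)
  have cardB: "card ?B = t" by (simp add: card_image)
  have cardU: "card ?U = r" unfolding r_def by (subst card_image) (auto intro: inj_onI)
  have cardR: "card (pverts ?E - ?B - ?U) = m"
  proof -
    interpret E: pair_graph ?E by (rule pair_graph_extremal_graph)
    show ?thesis
      using card_parts[OF E.pair_finite_verts split_joinD[OF E]] cardB cardU cardE nsum by linarith
  qed
  define l where "l = distance_spectral_radius ?E"
  have "Inl 0 \<in> ?B" using t1 by simp
  then have "?B \<noteq> {}" "2 \<le> card (pverts ?E)" using cardE nsum r(1) by (blast, linarith)
  \<comment> \<open>The Perron values of the extremal graph, to be placed onto \<open>G\<close>.\<close>
  note perron = split_join_perron[OF E this, unfolded cardB cardU cardR cardE l_def[symmetric]]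
  obtain a b c where pos: "0 < a" "0 < b" "0 < c"
    and eqs: "(l + 1) * a = real t * a + real m * b + real r * c"
      "(l + 1) * b = real t * a + real m * b + 2 * real r * c"
      "(l + 2) * c = real t * a + 2 * real m * b + 2 * real r * c"
    and ln: "real n - 1 \<le> l"
    by (rule perron)
  have notless: "\<not> l < distance_spectral_radius G" using assms(11) by (simp add: l_def)
  have nogain: "\<not> (2 * c * real (card AD) < b * real (card NU) \<or>
      AD = {} \<and> (\<exists>u\<in>?V. \<exists>v\<in>?V. u \<noteq> v \<and> (u, v) \<notin> parcs G \<and> split_dist A T u v = 1))"
    (is "\<not> ?gain")
  proof
    assume gain: ?gain
    have "l < distance_spectral_radius G"
      by (rule distance_spectral_radius_gt_split[OF pg conn sub _ pos _ _ _ AD_def NU_def gain])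
        (use eqs cards cardM indep in \<open>simp_all add: m_def\<close>)
    then show False using notless by contradiction
  qed
  have "(l + 2) * c = (l + 1 + real m) * b" using eqs(2,3) by (simp add: algebra_simps)
  moreover have "real m = real h + 2 * real j" by (simp add: m_def)
  moreover have "8 * real r - 2 \<le> real m"
  proof -
    have "8 * r \<le> m + 2" using assms(10) nsum k2 t1 by (simp add: r_def)
    then show ?thesis by linarith
  qed
  ultimately have ratio: "c < 2 * b" "2 * real r * c < (2 * real h + real j - 1) * b"
    using weight_ratio[of l c "real m" b "real h" "real j" "real t" "real r"] pos(2) h t1 r(1) ln nsum
    by auto
  \<comment> \<open>Each of the two sources of lost pairs is outweighed: \<open>r\<close> times \<open>j\<close> pairs by the second ratio,
    and \<open>w\<close> further pairs by the first one.\<close>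
  have "AD = {}"
  proof (rule ccontr)
    assume "AD \<noteq> {}"
    have "finite AD"
      by (rule finite_subset[of _ "?V \<times> ?V"]) (use sub pair_finite_verts in \<open>auto simp: AD_def\<close>)
    then have "0 < card AD" using \<open>AD \<noteq> {}\<close> by (simp add: card_gt_0_iff)
    then have "j \<noteq> 0 \<or> w \<noteq> 0" using alpha[folded AD_def] by (cases "j = 0") auto
    have "2 * c * real (card AD) \<le> 2 * c * (real r * real j + real w)"
      using alpha[folded AD_def] pos(3) by (intro mult_left_mono) (auto simp flip: of_nat_mult of_nat_add)
    also have "\<dots> = real j * (2 * real r * c) + real w * (2 * c)" by (simp add: algebra_simps)
    also have "\<dots> < real j * ((2 * real h + real j - 1) * b) + real w * (4 * b)"
    proof (cases "j = 0")
      case True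
      then show ?thesis using \<open>j \<noteq> 0 \<or> w \<noteq> 0\<close> ratio(1) by simp
    next
      case False
      then have "real j * (2 * real r * c) < real j * ((2 * real h + real j - 1) * b)"
        using ratio(2) by (intro mult_strict_left_mono) auto
      moreover have "real w * (2 * c) \<le> real w * (4 * b)" using ratio(1) by (intro mult_left_mono) auto
      ultimately show ?thesis by linarith
    qed
    also have "\<dots> = b * real (2 * j * h + j * (j - 1) + 4 * w)"
      by (cases j) (simp_all add: algebra_simps)
    also have "\<dots> \<le> b * real (card NU)"
      using nu[folded NU_def] pos(2) by (intro mult_left_mono) (simp_all only: of_nat_le_iff less_imp_le)
    finally show False using nogain by blast
  qed
  \<comment> \<open>Nothing is lost, so nothing may be gained either, and \<open>G\<close> has exactly the extremal structure.\<close>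
  moreover have "\<not> (\<exists>u\<in>?V. \<exists>v\<in>?V. u \<noteq> v \<and> (u, v) \<notin> parcs G \<and> split_dist A T u v = 1)"
    using nogain calculation by blast
  ultimately have "split_join G A T"
    unfolding split_join_def
  proof (intro conjI ballI pg sub)
    fix u v assume AD0: "AD = {}" and uv: "u \<in> ?V" "v \<in> ?V"
      and none: "\<not> (\<exists>u\<in>?V. \<exists>v\<in>?V. u \<noteq> v \<and> (u, v) \<notin> parcs G \<and> split_dist A T u v = 1)"
    have no: "(x, y) \<notin> parcs G" if "x \<in> T" "y \<in> ?V - A - T" for x y using AD0 that by (auto simp: AD_def)
    show "(u, v) \<in> parcs G \<longleftrightarrow> u \<noteq> v \<and> (u \<in> A \<or> v \<in> A \<or> u \<notin> T \<and> v \<notin> T)" (is "_ \<longleftrightarrow> ?R")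
    proof
      assume arc: "(u, v) \<in> parcs G"
      then have "u \<noteq> v" "(v, u) \<in> parcs G" using no_loops' arcs_symmetric by auto
      then show ?R using arc no[of u v] no[of v u] indep[of u v] uv by auto
    next
      assume ?R
      then have "split_dist A T u v = 1" "u \<noteq> v" by (auto simp: split_dist_def)
      then show "(u, v) \<in> parcs G" using none uv by blast
    qed
  qed
  then have "digraph_iso (with_proj G) (with_proj ?E)"
    using E by (rule split_join_digraph_iso) (use cards cardB cardU card_n cardE in auto)
  then show ?thesis ..
qed simp

end
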